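(* Let $1<\alpha<2$, $0<d<1-\frac1\alpha$, $1<p<\alpha$, let $M_d=\{M_d(t)\}_{t\in\mathbb{R}}$ be the linear fractional stable motion $M_d(t)=\frac{1}{\Gamma(d+1)}\int_{-\infty}^{\infty}[(t-x)_+^d-(-x)_+^d]\,dL_\alpha(x)$, and let $g:\mathbb{R}\to\mathbb{R}$ be in $B_{\alpha,p}$. Then there exists a sequence of simple functions $\phi_n:\mathbb{R}\to\mathbb{R}$, $n\in\mathbb{N}$, satisfying $\|\phi_n-g\|_{\alpha,p}\to0$ as $n\to\infty$, such that $I_{M_d}(\phi_n)$ converges in $L^p(\Omega,\mathbb{P})$ to a limit, denoted $I_{M_d}(g)=\int_{\mathbb{R}}g(x)\,dM_d(x)$, and $I_{M_d}(g)$ is independent of the approximating sequence $(\phi_n)$. Moreover, the isometry property holds: $$\|I_{M_d}(g)\|_{L^p(\Omega,\mathbb{P})}=\|g\|_{\alpha,p}.$$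
   Context: $\{L_\alpha(t)\}_{t\in\mathbb{R}}$ is a symmetric $\alpha$-stable ($S\alpha S$) process with Lebesgue control measure on a probability space $(\Omega,\mathcal F,\mathbb P)$. The stable integral $f\mapsto\int_{\mathbb{R}}f\,dL_\alpha$ is the associated linear map from $L^\alpha(\mathbb{R})$ to random variables, with $\mathbb{E}[\exp\{i\theta\int f\,dL_\alpha\}]=\exp\{-|\theta|^\alpha\int_{\mathbb{R}}|f(x)|^\alpha dx\}$ for $\theta\in\mathbb{R}$; thus $L_\alpha(1)=\int\mathbf 1_{(0,1]}\,dL_\alpha$ has characteristic function $e^{-|\theta|^\alpha}$. Here $u_+=\max\{u,0\}$. The right-sided Riemann-Liouville fractional integral is $(I_-^dg)(x)=\frac1{\Gamma(d)}\int_x^\infty g(t)(t-x)^{d-1}dt$. For $g\in L^1(\mathbb{R})\cap L^\alpha(\mathbb{R})$ one sets $\|g\|_{\alpha,p}=\left(\mathbb{E}|L_\alpha(1)|^p\right)^{1/p}\left(\int_{\mathbb{R}}|(I_-^dg)(x)|^\alpha dx\right)^{1/\alpha}$. $B_{\alpha,p}$ is the space $L^1(\mathbb{R})\cap L^\alpha(\mathbb{R})$ modulo the equivalence relation $f\sim g\iff\|f-g\|_{\alpha,p}=0$, with norm $\|\cdot\|_{\alpha,p}$. A simple function is $\phi=\sum_{i=1}^{n-1}a_i\mathbf 1_{(t_i,t_{i+1}]}$ with $a_i\in\mathbb{R}$ and $-\infty<t_1<\dots<t_n<\infty$; for it, $I_{M_d}(\phi)=\sum_{i=1}^{n-1}a_i[M_d(t_{i+1})-M_d(t_i)]$.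 *)

theory Defs
  imports "HOL-Probability.Probability"
begin

section \<open>The spaces \<open>L\<^sup>p\<close>\<close>

text \<open>Functions rather than classes modulo null sets. The norm is the Bochner integral, so it is
  only meaningful on members of \<open>Lp_space M p\<close>.\<close>

definition Lp_space :: "'a measure \<Rightarrow> real \<Rightarrow> ('a \<Rightarrow> real) set" where
  "Lp_space M p = {f \<in> borel_measurable M. integrable M (\<lambda>x. \<bar>f x\<bar> powr p)}"

definition Lp_norm :: "'a measure \<Rightarrow> real \<Rightarrow> ('a \<Rightarrow> real) \<Rightarrow> real" where
  "Lp_norm M p f = (LINT x|M. \<bar>f x\<bar> powr p) powr (1 / p)"

definition Lp_converges ::
    "'a measure \<Rightarrow> real \<Rightarrow> (nat \<Rightarrow> 'a \<Rightarrow> real) \<Rightarrow> ('a \<Rightarrow> real) \<Rightarrow> bool" where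
  "Lp_converges M p X Y \<longleftrightarrow> (\<forall>n. X n \<in> Lp_space M p) \<and> Y \<in> Lp_space M p \<and>
     (\<lambda>n. Lp_norm M p (\<lambda>\<omega>. X n \<omega> - Y \<omega>)) \<longlonglongrightarrow> 0"


section \<open>Stable motion, stable integral and linear fractional stable motion\<close>

locale SaS_motion = prob_space M for M :: "'a measure" +
  fixes \<alpha> :: real and L :: "real \<Rightarrow> 'a \<Rightarrow> real"
  assumes L_measurable: "\<And>t. L t \<in> borel_measurable M"
    and L_zero: "AE \<omega> in M. L 0 \<omega> = 0"
    and L_indep_increments: "\<And>(t :: nat \<Rightarrow> real) n. strict_mono t \<Longrightarrow>
      indep_vars (\<lambda>_. borel) (\<lambda>i \<omega>. L (t (Suc i)) \<omega> - L (t i) \<omega>) {..<n}"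
    and L_char_increments: "\<And>s t \<theta>. s \<le> t \<Longrightarrow>
      char (distr M borel (\<lambda>\<omega>. L t \<omega> - L s \<omega>)) \<theta> = of_real (exp (- (t - s) * \<bar>\<theta>\<bar> powr \<alpha>))"

text \<open>\<open>J f\<close> is the stable integral of \<open>f\<close> with respect to \<open>L\<close>. Linearity and the characteristic
  function make \<open>J\<close> continuous from \<open>L\<^sup>\<alpha>\<close> to convergence in probability, so the values on indicators
  of intervals determine \<open>J f\<close> almost surely.\<close>

locale stable_integral = SaS_motion M \<alpha> L
    for M :: "'a measure" and \<alpha> :: real and L :: "real \<Rightarrow> 'a \<Rightarrow> real" +
  fixes J :: "(real \<Rightarrow> real) \<Rightarrow> 'a \<Rightarrow> real"
  assumes J_measurable: "\<And>f. f \<in> Lp_space lborel \<alpha> \<Longrightarrow> J f \<in> borel_measurable M"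
    and J_linear: "\<And>f g a b. f \<in> Lp_space lborel \<alpha> \<Longrightarrow> g \<in> Lp_space lborel \<alpha> \<Longrightarrow>
      AE \<omega> in M. J (\<lambda>x. a * f x + b * g x) \<omega> = a * J f \<omega> + b * J g \<omega>"
    and J_indicator: "\<And>s t. s \<le> t \<Longrightarrow> AE \<omega> in M. J (indicator {s<..t}) \<omega> = L t \<omega> - L s \<omega>"
    and J_char: "\<And>f \<theta>. f \<in> Lp_space lborel \<alpha> \<Longrightarrow>
      char (distr M borel (J f)) \<theta>
        = of_real (exp (- (\<bar>\<theta>\<bar> powr \<alpha> * (LINT x|lborel. \<bar>f x\<bar> powr \<alpha>))))"

definition LFSM :: "((real \<Rightarrow> real) \<Rightarrow> 'a \<Rightarrow> real) \<Rightarrow> real \<Rightarrow> real \<Rightarrow> 'a \<Rightarrow> real" where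
  "LFSM J d t \<omega> = 1 / Gamma (d + 1) * J (\<lambda>x. max (t - x) 0 powr d - max (- x) 0 powr d) \<omega>"


section \<open>The space \<open>B\<close>\<close>

definition RL_integral :: "real \<Rightarrow> (real \<Rightarrow> real) \<Rightarrow> real \<Rightarrow> real" where
  "RL_integral d g x = 1 / Gamma d * (LINT t:{x<..}|lborel. g t * (t - x) powr (d - 1))"

definition B_norm ::
    "'a measure \<Rightarrow> (real \<Rightarrow> 'a \<Rightarrow> real) \<Rightarrow> real \<Rightarrow> real \<Rightarrow> real \<Rightarrow> (real \<Rightarrow> real) \<Rightarrow> real" where
  "B_norm M L \<alpha> d p g = Lp_norm M p (L 1) * Lp_norm lborel \<alpha> (RL_integral d g)"

definition B_rel ::
    "'a measure \<Rightarrow> (real \<Rightarrow> 'a \<Rightarrow> real) \<Rightarrow> real \<Rightarrow> real \<Rightarrow> real \<Rightarrow> ((real \<Rightarrow> real) \<times> (real \<Rightarrow> real)) set"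
  where "B_rel M L \<alpha> d p =
    {(f, g). f \<in> Lp_space lborel 1 \<inter> Lp_space lborel \<alpha> \<and> g \<in> Lp_space lborel 1 \<inter> Lp_space lborel \<alpha> \<and>
             B_norm M L \<alpha> d p (\<lambda>x. f x - g x) = 0}"

definition B_space ::
    "'a measure \<Rightarrow> (real \<Rightarrow> 'a \<Rightarrow> real) \<Rightarrow> real \<Rightarrow> real \<Rightarrow> real \<Rightarrow> (real \<Rightarrow> real) set set" where
  "B_space M L \<alpha> d p = (Lp_space lborel 1 \<inter> Lp_space lborel \<alpha>) // B_rel M L \<alpha> d p"


section \<open>Step functions and their integrals\<close>

definition step_repr :: "(real \<Rightarrow> real) \<Rightarrow> nat \<Rightarrow> (nat \<Rightarrow> real) \<Rightarrow> (nat \<Rightarrow> real) \<Rightarrow> bool" where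
  "step_repr \<phi> n a t \<longleftrightarrow> strict_mono_on {1..n} t \<and>
     \<phi> = (\<lambda>x. \<Sum>i=1..<n. a i * indicator {t i<..t (Suc i)} x)"

definition step_function :: "(real \<Rightarrow> real) \<Rightarrow> bool" where
  "step_function \<phi> \<longleftrightarrow> (\<exists>n a t. step_repr \<phi> n a t)"

definition step_integral :: "(real \<Rightarrow> 'a \<Rightarrow> real) \<Rightarrow> (real \<Rightarrow> real) \<Rightarrow> 'a \<Rightarrow> real" where
  "step_integral X \<phi> \<omega> = (THE v. \<exists>n a t. step_repr \<phi> n a t \<and>
     v = (\<Sum>i=1..<n. a i * (X (t (Suc i)) \<omega> - X (t i) \<omega>)))"

text \<open>The integral does not depend on the representation: it equals the sum over the jump points
  \<open>u\<close> of \<open>X u\<close> times the jump \<open>\<phi> u - \<phi> (u+)\<close>.\<close>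

lemma step_repr_right_limit:
  assumes "step_repr \<phi> n a t"
  shows "(\<phi> \<longlongrightarrow> \<phi> u - (\<Sum>i=1..<n. a i * (of_bool (u = t (Suc i)) - of_bool (u = t i)))) (at_right u)"
proof -
  have ind: "((\<lambda>x. indicator {s<..r} x :: real) \<longlongrightarrow>
      indicator {s<..r} u - (of_bool (u = r) - of_bool (u = s))) (at_right u)"
    if "s < r" for s r :: real
  proof (rule tendsto_eventually)
    have "\<forall>\<^sub>F x in at_right u. x \<in> {u<..<(if u < s then s else if u < r then r else u + 1)}"
      by (rule eventually_at_right_real) auto
    then show "\<forall>\<^sub>F x in at_right u.
        (indicator {s<..r} x :: real) = indicator {s<..r} u - (of_bool (u = r) - of_bool (u = s))"
      by eventually_elim (use that in \<open>auto simp: indicator_def split: if_splits\<close>)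
  qed
  have mono: "t i < t (Suc i)" if "i \<in> {1..<n}" for i
  proof -
    have "strict_mono_on {1..n} t" "i \<in> {1..n}" "Suc i \<in> {1..n}"
      using assms that by (simp_all add: step_repr_def)
    then show ?thesis
      using strict_mono_onD[of "{1..n}" t i "Suc i"] by blast
  qed
  have "((\<lambda>x. \<Sum>i=1..<n. a i * indicator {t i<..t (Suc i)} x) \<longlongrightarrow>
      (\<Sum>i=1..<n. a i * (indicator {t i<..t (Suc i)} u
         - (of_bool (u = t (Suc i)) - of_bool (u = t i))))) (at_right u)"
    by (intro tendsto_sum tendsto_mult tendsto_const ind mono)
  then show ?thesis
    using assms by (simp add: step_repr_def right_diff_distrib sum_subtractf)
qed

lemma step_integral_unique:
  fixes F :: "real \<Rightarrow> real"
  assumes r1: "step_repr \<phi> n a t" and r2: "step_repr \<phi> m b s"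
  shows "(\<Sum>i=1..<n. a i * (F (t (Suc i)) - F (t i))) = (\<Sum>i=1..<m. b i * (F (s (Suc i)) - F (s i)))"
proof -
  define S where "S = t ` {1..n} \<union> s ` {1..m}"
  have S: "finite S" by (simp add: S_def)
  have expand: "(\<Sum>i=1..<k. c i * (F (r (Suc i)) - F (r i))) =
      (\<Sum>u\<in>S. F u * (\<Sum>i=1..<k. c i * (of_bool (u = r (Suc i)) - of_bool (u = r i))))"
    if "r ` {1..k} \<subseteq> S" for k and c r :: "nat \<Rightarrow> real"
  proof -
    have pt: "F y = (\<Sum>u\<in>S. F u * of_bool (u = y))" if "y \<in> S" for y
      using S that by (simp add: of_bool_def if_distrib cong: if_cong)
    have "c i * (F (r (Suc i)) - F (r i)) =
        (\<Sum>u\<in>S. F u * (c i * (of_bool (u = r (Suc i)) - of_bool (u = r i))))"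
      if "i \<in> {1..<k}" for i
    proof -
      have "r (Suc i) \<in> S" "r i \<in> S"
        using that \<open>r ` {1..k} \<subseteq> S\<close> by auto
      then have "F (r (Suc i)) - F (r i) =
          (\<Sum>u\<in>S. F u * of_bool (u = r (Suc i))) - (\<Sum>u\<in>S. F u * of_bool (u = r i))"
        by (simp only: pt[symmetric])
      then show ?thesis
        by (simp only: sum_subtractf[symmetric] right_diff_distrib[symmetric] sum_distrib_left
            mult.left_commute)
    qed
    then have "(\<Sum>i=1..<k. c i * (F (r (Suc i)) - F (r i))) = (\<Sum>i=1..<k. \<Sum>u\<in>S.
        F u * (c i * (of_bool (u = r (Suc i)) - of_bool (u = r i))))"
      by (intro sum.cong) auto
    also have "\<dots> = (\<Sum>u\<in>S. \<Sum>i=1..<k.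
        F u * (c i * (of_bool (u = r (Suc i)) - of_bool (u = r i))))"
      by (rule sum.swap)
    finally show ?thesis by (simp only: sum_distrib_left)
  qed
  have jumps: "(\<Sum>i=1..<n. a i * (of_bool (u = t (Suc i)) - of_bool (u = t i)) :: real) =
        (\<Sum>i=1..<m. b i * (of_bool (u = s (Suc i)) - of_bool (u = s i)))" for u
    using tendsto_unique[OF _ step_repr_right_limit[OF r1, of u] step_repr_right_limit[OF r2, of u]]
    by simp
  have t: "t ` {1..n} \<subseteq> S" and s: "s ` {1..m} \<subseteq> S"
    by (simp_all only: S_def Un_upper1 Un_upper2)
  show ?thesis
    unfolding expand[OF t, of a] expand[OF s, of b] jumps by (rule refl)
qed

lemma step_integral_eq:
  assumes "step_repr \<phi> n a t"
  shows "step_integral X \<phi> \<omega> = (\<Sum>i=1..<n. a i * (X (t (Suc i)) \<omega> - X (t i) \<omega>))"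
  unfolding step_integral_def
proof (rule the_equality)
  show "\<exists>m b s. step_repr \<phi> m b s \<and>
      (\<Sum>i=1..<n. a i * (X (t (Suc i)) \<omega> - X (t i) \<omega>))
        = (\<Sum>i=1..<m. b i * (X (s (Suc i)) \<omega> - X (s i) \<omega>))"
    using assms by (intro exI conjI) (assumption, rule refl)
next
  fix v
  assume "\<exists>m b s. step_repr \<phi> m b s \<and> v = (\<Sum>i=1..<m. b i * (X (s (Suc i)) \<omega> - X (s i) \<omega>))"
  then show "v = (\<Sum>i=1..<n. a i * (X (t (Suc i)) \<omega> - X (t i) \<omega>))"
    by (elim exE conjE) (simp only: step_integral_unique[OF _ assms, where F = "\<lambda>u. X u \<omega>"])
qed

end

theory Submission
  imports Defs
begin

text \<open>
  The integral is \<open>J (RL_integral d g)\<close>. Comparing characteristic functions, \<open>J f\<close> has the law of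
  \<open>\<parallel>f\<parallel>\<^sub>\<alpha> L 1\<close>, and \<open>L 1\<close> has moments of every order below \<open>\<alpha>\<close>; so
  \<open>\<parallel>J f\<parallel>\<^sub>p = \<parallel>L 1\<parallel>\<^sub>p \<parallel>f\<parallel>\<^sub>\<alpha>\<close>. The fractional integral of \<open>indicator {s<..t}\<close> is, up to the factor
  \<open>Gamma (d + 1)\<close>, the difference of the kernels of the motion at \<open>t\<close> and \<open>s\<close>, hence on a step
  function \<open>\<phi>\<close> the step integral is \<open>J (RL_integral d \<phi>)\<close> almost surely and its distance to the
  integral of \<open>g\<close> in \<open>L\<^sup>p\<close> equals \<open>B_norm\<close> of \<open>\<phi> - g\<close>. Step functions are dense because they are
  dense in \<open>L\<^sup>1 \<inter> L\<^sup>\<alpha>\<close>, on which \<open>RL_integral d\<close> is bounded into \<open>L\<^sup>\<alpha>\<close> by Young's inequality.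
\<close>

section \<open>Inequalities in \<open>L\<^sup>p\<close>\<close>

text \<open>Since the limit is explicit, its distance to each step integral is an exact
  \<open>B_norm\<close>; convergence along every approximating sequence and the isometry come from
  the same norm identity. What shapes the details is that identities hold only up to null sets, on
  two levels. A Bochner integral is 0 where its integrand is not integrable, so
  \<open>RL_integral d\<close> is linear only at almost every point. And \<open>J\<close> acts on
  functions, not on classes: that it respects equality almost everywhere is derived from the norm
  identity for a difference. The kernel u^(d - 1) on (0, \<infinity>) lies in no L^q: too large at 0
  for some exponents, too large at infinity for the others. This is why control in L^1 and in
  L^\<alpha> together is used, each for one part of the kernel. Of the law of \<open>L 1\<close>
  only the characteristic function is given, so its moments are estimated from that function
  directly, with no density or tail asymptotics.\<close>

lemma powr_add_le:
  fixes a b p :: real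
  assumes "0 \<le> p"
  shows "\<bar>a + b\<bar> powr p \<le> 2 powr p * (\<bar>a\<bar> powr p + \<bar>b\<bar> powr p)"
proof -
  \<comment> \<open>The sum is at most twice the larger modulus. This covers every exponent p \<ge>
    0 at once, and the constant is harmless where finiteness, a bound or convergence to 0 is
    wanted.\<close>
  have "\<bar>a + b\<bar> powr p \<le> (2 * max \<bar>a\<bar> \<bar>b\<bar>) powr p"
    using assms by (intro powr_mono2) auto
  also have "\<dots> = 2 powr p * max \<bar>a\<bar> \<bar>b\<bar> powr p"
    by (simp add: powr_mult)
  also have "\<dots> \<le> 2 powr p * (\<bar>a\<bar> powr p + \<bar>b\<bar> powr p)"
    by (intro mult_left_mono) (auto simp: max_def)
  finally show ?thesis .
qed

lemma Lp_space_iff: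
  "f \<in> Lp_space M p \<longleftrightarrow> f \<in> borel_measurable M \<and> integrable M (\<lambda>x. \<bar>f x\<bar> powr p)"
  by (simp add: Lp_space_def)

lemma Lp_space_lincomb:
  assumes "0 \<le> p" and f: "f \<in> Lp_space M p" and g: "g \<in> Lp_space M p"
  shows "(\<lambda>x. a * f x + b * g x) \<in> Lp_space M p"
proof -
  have [measurable]: "f \<in> borel_measurable M" "g \<in> borel_measurable M"
    using f g by (auto simp: Lp_space_iff)
  have "integrable M (\<lambda>x. \<bar>a * f x + b * g x\<bar> powr p)"
  proof (rule Bochner_Integration.integrable_bound)
    show "integrable M (\<lambda>x. 2 powr p * (\<bar>a\<bar> powr p * \<bar>f x\<bar> powr p + \<bar>b\<bar> powr p * \<bar>g x\<bar> powr p))"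
      using f g by (simp add: Lp_space_iff)
    show "AE x in M. norm (\<bar>a * f x + b * g x\<bar> powr p)
        \<le> norm (2 powr p * (\<bar>a\<bar> powr p * \<bar>f x\<bar> powr p + \<bar>b\<bar> powr p * \<bar>g x\<bar> powr p))"
      using powr_add_le[OF \<open>0 \<le> p\<close>, of "a * f _" "b * g _"]
      by (auto simp: abs_mult powr_mult)
  qed measurable
  then show ?thesis by (simp add: Lp_space_iff)
qed

lemma Lp_space_diff:
  assumes "0 \<le> p" "f \<in> Lp_space M p" "g \<in> Lp_space M p"
  shows "(\<lambda>x. f x - g x) \<in> Lp_space M p"
  using Lp_space_lincomb[OF assms, of 1 "- 1"] by simp

lemma Lp_space_cmult:
  assumes "0 \<le> p" "f \<in> Lp_space M p"
  shows "(\<lambda>x. c * f x) \<in> Lp_space M p"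
  using Lp_space_lincomb[OF assms assms(2), of c 0] by simp

lemma Lp_space_sum:
  assumes "0 \<le> p" "finite A" "\<And>i. i \<in> A \<Longrightarrow> f i \<in> Lp_space M p"
  shows "(\<lambda>x. \<Sum>i\<in>A. c i * f i x) \<in> Lp_space M p"
  using assms(2,3)
proof (induction A)
  case empty
  then show ?case by (simp add: Lp_space_iff)
next
  case (insert i A)
  then show ?case
    using Lp_space_lincomb[OF \<open>0 \<le> p\<close>, of "f i" M "\<lambda>x. \<Sum>i\<in>A. c i * f i x" "c i" 1] by simp
qed

lemma indicator_in_Lp_space:
  assumes "A \<in> sets M" "emeasure M A < \<infinity>"
  shows "(indicator A :: _ \<Rightarrow> real) \<in> Lp_space M p"
proof -
  have "(\<lambda>x. \<bar>indicator A x :: real\<bar> powr p) = indicator A"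
    by (auto simp: indicator_def)
  then show ?thesis
    using assms by (simp add: Lp_space_iff)
qed

lemma Lp_norm_cong_AE:
  assumes "f \<in> borel_measurable M" "g \<in> borel_measurable M" "AE x in M. f x = g x"
  shows "Lp_norm M p f = Lp_norm M p g"
proof -
  have "(LINT x|M. \<bar>f x\<bar> powr p) = (LINT x|M. \<bar>g x\<bar> powr p)"
    using assms by (intro integral_cong_AE) auto
  then show ?thesis by (simp add: Lp_norm_def)
qed

lemma AE_eq_0_if_Lp_norm_eq_0:
  assumes "f \<in> Lp_space M p" "Lp_norm M p f = 0"
  shows "AE x in M. f x = 0"
proof -
  have "(LINT x|M. \<bar>f x\<bar> powr p) = 0"
    using assms(2) by (simp add: Lp_norm_def)
  then have "AE x in M. \<bar>f x\<bar> powr p = 0"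
    using assms(1) by (subst (asm) integral_nonneg_eq_0_iff_AE) (auto simp: Lp_space_iff)
  then show ?thesis by auto
qed

text \<open>Jensen's inequality for the measure with density w, not normalized: a tangent-line bound
  for the power \<alpha> is integrated and the point of tangency optimized. Kernel and function can
  each play the weight, which yields both forms of Young's inequality below.\<close>

lemma weighted_power_mean:
  fixes w h :: "'a \<Rightarrow> real"
  assumes \<alpha>: "1 < \<alpha>"
    and [measurable]: "h \<in> borel_measurable M"
    and w: "integrable M w" and wh: "integrable M (\<lambda>x. w x * h x powr \<alpha>)"
    and nn: "\<And>x. 0 \<le> w x" "\<And>x. 0 \<le> h x"
  shows "integrable M (\<lambda>x. w x * h x)"
    and "(LINT x|M. w x * h x) powr \<alpha>
      \<le> (LINT x|M. w x) powr (\<alpha> - 1) * (LINT x|M. w x * h x powr \<alpha>)"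
proof -
  have [measurable]: "w \<in> borel_measurable M" using w by simp
  \<comment> \<open>Weighted AM-GM for \<open>A powr (1 - \<alpha>) * y powr \<alpha>\<close> and
    \<open>A\<close> with weights 1 / \<alpha> and 1 - 1 / \<alpha>, whose geometric mean collapses
    to y. Equality holds at y = A, the point of tangency.\<close>
  have young: "y \<le> (A powr (1 - \<alpha>) * y powr \<alpha> + (\<alpha> - 1) * A) / \<alpha>" if "0 \<le> y" "0 < A" for y A :: real
  proof (cases "y = 0")
    case True
    then show ?thesis using that \<alpha> by simp
  next
    case False
    have "(A powr (1 - \<alpha>) * y powr \<alpha>) powr (1 / \<alpha>) * A powr (1 - 1 / \<alpha>)
        \<le> 1 / \<alpha> * (A powr (1 - \<alpha>) * y powr \<alpha>) + (1 - 1 / \<alpha>) * A"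
      using that \<alpha> False by (intro Youngs_inequality_0) auto
    moreover have "(A powr (1 - \<alpha>) * y powr \<alpha>) powr (1 / \<alpha>) = A powr (1 / \<alpha> - 1) * y"
      using that \<alpha> False by (simp add: powr_mult powr_powr diff_divide_distrib)
    moreover have "A powr (1 / \<alpha> - 1) * y * A powr (1 - 1 / \<alpha>) = y"
      using that by (simp add: powr_diff)
    ultimately have "y \<le> 1 / \<alpha> * (A powr (1 - \<alpha>) * y powr \<alpha>) + (1 - 1 / \<alpha>) * A"
      by simp
    also have "\<dots> = (A powr (1 - \<alpha>) * y powr \<alpha> + (\<alpha> - 1) * A) / \<alpha>"
      using \<alpha> by (simp add: field_simps)
    finally show ?thesis .
  qed
  show int: "integrable M (\<lambda>x. w x * h x)"
  proof (rule Bochner_Integration.integrable_bound)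
    show "integrable M (\<lambda>x. w x * h x powr \<alpha> + w x)"
      using w wh by simp
    have "h x \<le> h x powr \<alpha> + 1" for x
      using nn(2)[of x] \<alpha> powr_mono[of 1 \<alpha> "h x"] by (cases "1 \<le> h x") (auto simp: add_increasing)
    then have "w x * h x \<le> w x * h x powr \<alpha> + w x" for x
      using mult_left_mono[OF _ nn(1), of "h x" "h x powr \<alpha> + 1" x] by (simp add: algebra_simps)
    then show "AE x in M. norm (w x * h x) \<le> norm (w x * h x powr \<alpha> + w x)"
      using nn by (intro AE_I2) (simp add: abs_mult)
  qed measurable
  define W V where "W = (LINT x|M. w x)" and "V = (LINT x|M. w x * h x powr \<alpha>)"
  have "0 \<le> W" "0 \<le> V" using nn by (auto simp: W_def V_def)
  have "(LINT x|M. w x * h x) powr \<alpha> \<le> W powr (\<alpha> - 1) * V"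
  proof (cases "W = 0 \<or> V = 0")
    case True
    then have "AE x in M. w x * h x = 0"
    proof
      assume "W = 0"
      then have "AE x in M. w x = 0"
        unfolding W_def using w nn by (subst (asm) integral_nonneg_eq_0_iff_AE) auto
      then show ?thesis by eventually_elim simp
    next
      assume "V = 0"
      then have "AE x in M. w x * h x powr \<alpha> = 0"
        unfolding V_def using wh nn by (subst (asm) integral_nonneg_eq_0_iff_AE) auto
      then show ?thesis by eventually_elim auto
    qed
    then have "(LINT x|M. w x * h x) = 0"
      by (simp add: integral_eq_zero_AE)
    then show ?thesis using \<open>0 \<le> V\<close> by simp
  next
    case False
    then have pos: "0 < W" "0 < V" using \<open>0 \<le> W\<close> \<open>0 \<le> V\<close> by auto
    \<comment> \<open>The power mean of h with respect to normalized w, which optimizes the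
      integrated bound. It has to be positive, hence the separate case W = 0 or V = 0, where w * h
      vanishes almost everywhere.\<close>
    define A where "A = (V / W) powr (1 / \<alpha>)"
    have A: "0 < A" and AV: "A powr \<alpha> * W = V"
      using pos \<alpha> by (auto simp: A_def powr_powr)
    have "(LINT x|M. w x * h x)
        \<le> (LINT x|M. (A powr (1 - \<alpha>) * (w x * h x powr \<alpha>) + (\<alpha> - 1) * A * w x) / \<alpha>)"
    proof (rule integral_mono)
      show "w x * h x \<le> (A powr (1 - \<alpha>) * (w x * h x powr \<alpha>) + (\<alpha> - 1) * A * w x) / \<alpha>" for x
        using mult_left_mono[OF young[OF nn(2)[of x] A] nn(1)[of x]] by (simp add: algebra_simps)
    qed (use int w wh in auto)
    also have "\<dots> = (A powr (1 - \<alpha>) * V + (\<alpha> - 1) * A * W) / \<alpha>"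
      using w wh by (simp add: V_def W_def)
    also have "A powr (1 - \<alpha>) * V = A * W"
      using A by (simp add: AV[symmetric] powr_diff)
    also have "(A * W + (\<alpha> - 1) * A * W) / \<alpha> = A * W"
      using \<alpha> by (simp add: field_simps)
    finally have "(LINT x|M. w x * h x) powr \<alpha> \<le> (A * W) powr \<alpha>"
      using \<alpha> nn by (intro powr_mono2) auto
    also have "\<dots> = W powr (\<alpha> - 1) * V"
      using pos by (simp add: powr_mult AV[symmetric] powr_diff)
    finally show ?thesis .
  qed
  then show "(LINT x|M. w x * h x) powr \<alpha>
      \<le> (LINT x|M. w x) powr (\<alpha> - 1) * (LINT x|M. w x * h x powr \<alpha>)"
    by (simp only: W_def V_def)
qed

section \<open>Kernels of the form \<open>B (t - x)\<close> and two endpoint cases of Young's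
  inequality\<close>

lemma convolution_integrable:
  fixes A B :: "real \<Rightarrow> real"
  assumes A: "integrable lborel A" and B: "integrable lborel B"
  shows "AE x in lborel. integrable lborel (\<lambda>t. B (t - x) * A t)"
    and "integrable lborel (\<lambda>x. LINT t|lborel. B (t - x) * A t)"
    and "(LINT x|lborel. LINT t|lborel. B (t - x) * A t)
      = (LINT t|lborel. B t) * (LINT t|lborel. A t)"
proof -
  have [measurable]: "A \<in> borel_measurable borel" "B \<in> borel_measurable borel"
    using A B by (auto dest: borel_measurable_integrable)
  \<comment> \<open>Integrating over x first is easy: x \<mapsto> t - x preserves Lebesgue measure,
    so the inner integral contributes the integral of B, whatever t is.\<close>
  have shift: "integrable lborel (\<lambda>x. C (t - x))"
      "(LINT x|lborel. C (t - x)) = (LINT x|lborel. C x)"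
    if "integrable lborel C" for C :: "real \<Rightarrow> real" and t
    using lborel_integrable_real_affine[OF that, of "-1" t]
      lborel_integral_real_affine[of "-1" C t] by simp_all
  have int: "integrable (lborel \<Otimes>\<^sub>M lborel) (\<lambda>(t, x). B (t - x) * A t)"
  proof (rule lborel_pair.Fubini_integrable)
    show "integrable lborel (\<lambda>t. LINT x|lborel. norm (case (t, x) of (t, x) \<Rightarrow> B (t - x) * A t))"
      using A shift(2)[of "\<lambda>x. \<bar>B x\<bar>"] B by (simp add: abs_mult)
    show "AE t in lborel. integrable lborel (\<lambda>x. case (t, x) of (t, x) \<Rightarrow> B (t - x) * A t)"
      using shift(1)[OF B] by simp
  qed measurable
  have int': "integrable (lborel \<Otimes>\<^sub>M lborel) (\<lambda>(x, t). B (t - x) * A t)"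
    using lborel_pair.integrable_product_swap[OF int] by simp
  show "AE x in lborel. integrable lborel (\<lambda>t. B (t - x) * A t)"
    using lborel_pair.AE_integrable_fst'[OF int'] by simp
  show "integrable lborel (\<lambda>x. LINT t|lborel. B (t - x) * A t)"
    using lborel_pair.integrable_fst'[OF int'] by simp
  have "(LINT x|lborel. LINT t|lborel. B (t - x) * A t)
      = (LINT t|lborel. LINT x|lborel. B (t - x) * A t)"
    using lborel_pair.Fubini_integral[of "\<lambda>t x. B (t - x) * A t"] int by simp
  also have "\<dots> = (LINT t|lborel. B t) * (LINT t|lborel. A t)"
    using shift(2)[OF B] by simp
  finally show "(LINT x|lborel. LINT t|lborel. B (t - x) * A t)
      = (LINT t|lborel. B t) * (LINT t|lborel. A t)" .
qed

text \<open>With \<open>K (t - x)\<close> as the weight, the power mean leaves the convolution of K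
  with |g|^\<alpha>, whose integral factorizes.\<close>

lemma young_kernel_L1:
  fixes K g :: "real \<Rightarrow> real"
  assumes \<alpha>: "1 < \<alpha>" and K: "integrable lborel K" "\<And>x. 0 \<le> K x" and g: "g \<in> Lp_space lborel \<alpha>"
  shows "AE x in lborel. integrable lborel (\<lambda>t. K (t - x) * \<bar>g t\<bar>)"
    and "integrable lborel (\<lambda>x. (LINT t|lborel. K (t - x) * \<bar>g t\<bar>) powr \<alpha>)"
    and "(LINT x|lborel. (LINT t|lborel. K (t - x) * \<bar>g t\<bar>) powr \<alpha>)
      \<le> (LINT t|lborel. K t) powr \<alpha> * (LINT t|lborel. \<bar>g t\<bar> powr \<alpha>)"
proof -
  have [measurable]: "g \<in> borel_measurable borel" "K \<in> borel_measurable borel"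
    using g K by (auto simp: Lp_space_iff dest: borel_measurable_integrable)
  have g': "integrable lborel (\<lambda>t. \<bar>g t\<bar> powr \<alpha>)" using g by (simp add: Lp_space_iff)
  note conv = convolution_integrable[OF g' K(1)]
  have shift: "integrable lborel (\<lambda>t. K (t - x))" "(LINT t|lborel. K (t - x)) = (LINT t|lborel. K t)" for x
    using lborel_integrable_real_affine[OF K(1), of 1 "- x"]
      lborel_integral_real_affine[of 1 K "- x"] by simp_all
  have ptwise: "AE x in lborel. integrable lborel (\<lambda>t. K (t - x) * \<bar>g t\<bar>) \<and>
      (LINT t|lborel. K (t - x) * \<bar>g t\<bar>) powr \<alpha>
        \<le> (LINT t|lborel. K t) powr (\<alpha> - 1) * (LINT t|lborel. K (t - x) * \<bar>g t\<bar> powr \<alpha>)"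
    using conv(1)
  proof eventually_elim
    case (elim x)
    show ?case
      using weighted_power_mean[OF \<alpha>, of "\<lambda>t. \<bar>g t\<bar>" lborel "\<lambda>t. K (t - x)"] elim shift[of x] K(2)
      by simp
  qed
  then show "AE x in lborel. integrable lborel (\<lambda>t. K (t - x) * \<bar>g t\<bar>)"
    by eventually_elim simp
  show int: "integrable lborel (\<lambda>x. (LINT t|lborel. K (t - x) * \<bar>g t\<bar>) powr \<alpha>)"
  proof (rule Bochner_Integration.integrable_bound)
    show "integrable lborel (\<lambda>x. (LINT t|lborel. K t) powr (\<alpha> - 1)
        * (LINT t|lborel. K (t - x) * \<bar>g t\<bar> powr \<alpha>))"
      using conv(2) by simp
    show "AE x in lborel. norm ((LINT t|lborel. K (t - x) * \<bar>g t\<bar>) powr \<alpha>)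
      \<le> norm ((LINT t|lborel. K t) powr (\<alpha> - 1) * (LINT t|lborel. K (t - x) * \<bar>g t\<bar> powr \<alpha>))"
      using ptwise by eventually_elim auto
  qed measurable
  have "(LINT x|lborel. (LINT t|lborel. K (t - x) * \<bar>g t\<bar>) powr \<alpha>)
      \<le> (LINT x|lborel. (LINT t|lborel. K t) powr (\<alpha> - 1) * (LINT t|lborel. K (t - x) * \<bar>g t\<bar> powr \<alpha>))"
    by (rule integral_mono_AE) (use int conv(2) ptwise in auto)
  also have "\<dots> = (LINT t|lborel. K t) powr (\<alpha> - 1) * ((LINT t|lborel. K t) * (LINT t|lborel. \<bar>g t\<bar> powr \<alpha>))"
    by (simp add: conv(3))
  also have "\<dots> = (LINT t|lborel. K t) powr \<alpha> * (LINT t|lborel. \<bar>g t\<bar> powr \<alpha>)"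
    using K(2) by (cases "(LINT t|lborel. K t) = 0") (simp_all add: powr_diff)
  finally show "(LINT x|lborel. (LINT t|lborel. K (t - x) * \<bar>g t\<bar>) powr \<alpha>)
      \<le> (LINT t|lborel. K t) powr \<alpha> * (LINT t|lborel. \<bar>g t\<bar> powr \<alpha>)" .
qed

text \<open>The roles are exchanged: |g| is the weight and the kernel is averaged, so that its power
  \<alpha> is what gets integrated.\<close>

lemma young_kernel_Lp:
  fixes K g :: "real \<Rightarrow> real"
  assumes \<alpha>: "1 < \<alpha>" and K: "K \<in> Lp_space lborel \<alpha>" "\<And>x. 0 \<le> K x" and g: "integrable lborel g"
  shows "AE x in lborel. integrable lborel (\<lambda>t. K (t - x) * \<bar>g t\<bar>)"
    and "integrable lborel (\<lambda>x. (LINT t|lborel. K (t - x) * \<bar>g t\<bar>) powr \<alpha>)"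
    and "(LINT x|lborel. (LINT t|lborel. K (t - x) * \<bar>g t\<bar>) powr \<alpha>)
      \<le> (LINT t|lborel. K t powr \<alpha>) * (LINT t|lborel. \<bar>g t\<bar>) powr \<alpha>"
proof -
  have [measurable]: "g \<in> borel_measurable borel" "K \<in> borel_measurable borel"
    using g K by (auto simp: Lp_space_iff dest: borel_measurable_integrable)
  have K': "integrable lborel (\<lambda>t. K t powr \<alpha>)" using K by (simp add: Lp_space_iff)
  have g': "integrable lborel (\<lambda>t. \<bar>g t\<bar>)" using g by simp
  note conv = convolution_integrable[OF g' K']
  have ptwise: "AE x in lborel. integrable lborel (\<lambda>t. K (t - x) * \<bar>g t\<bar>) \<and>
      (LINT t|lborel. K (t - x) * \<bar>g t\<bar>) powr \<alpha>
        \<le> (LINT t|lborel. \<bar>g t\<bar>) powr (\<alpha> - 1) * (LINT t|lborel. K (t - x) powr \<alpha> * \<bar>g t\<bar>)"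
    using conv(1)
  proof eventually_elim
    case (elim x)
    show ?case
      using weighted_power_mean[OF \<alpha>, of "\<lambda>t. K (t - x)" lborel "\<lambda>t. \<bar>g t\<bar>"] elim g' K(2)
      by (simp add: mult.commute)
  qed
  then show "AE x in lborel. integrable lborel (\<lambda>t. K (t - x) * \<bar>g t\<bar>)"
    by eventually_elim simp
  show int: "integrable lborel (\<lambda>x. (LINT t|lborel. K (t - x) * \<bar>g t\<bar>) powr \<alpha>)"
  proof (rule Bochner_Integration.integrable_bound)
    show "integrable lborel (\<lambda>x. (LINT t|lborel. \<bar>g t\<bar>) powr (\<alpha> - 1)
        * (LINT t|lborel. K (t - x) powr \<alpha> * \<bar>g t\<bar>))"
      using conv(2) by simp
    show "AE x in lborel. norm ((LINT t|lborel. K (t - x) * \<bar>g t\<bar>) powr \<alpha>)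
      \<le> norm ((LINT t|lborel. \<bar>g t\<bar>) powr (\<alpha> - 1) * (LINT t|lborel. K (t - x) powr \<alpha> * \<bar>g t\<bar>))"
      using ptwise by eventually_elim auto
  qed measurable
  have "(LINT x|lborel. (LINT t|lborel. K (t - x) * \<bar>g t\<bar>) powr \<alpha>)
      \<le> (LINT x|lborel. (LINT t|lborel. \<bar>g t\<bar>) powr (\<alpha> - 1) * (LINT t|lborel. K (t - x) powr \<alpha> * \<bar>g t\<bar>))"
    by (rule integral_mono_AE) (use int conv(2) ptwise in auto)
  also have "\<dots> = (LINT t|lborel. \<bar>g t\<bar>) powr (\<alpha> - 1) * ((LINT t|lborel. K t powr \<alpha>) * (LINT t|lborel. \<bar>g t\<bar>))"
    by (simp add: conv(3))
  also have "\<dots> = (LINT t|lborel. K t powr \<alpha>) * (LINT t|lborel. \<bar>g t\<bar>) powr \<alpha>"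
    by (cases "(LINT t|lborel. \<bar>g t\<bar>) = 0") (simp_all add: powr_diff)
  finally show "(LINT x|lborel. (LINT t|lborel. K (t - x) * \<bar>g t\<bar>) powr \<alpha>)
      \<le> (LINT t|lborel. K t powr \<alpha>) * (LINT t|lborel. \<bar>g t\<bar>) powr \<alpha>" .
qed

section \<open>The Riemann-Liouville integral on \<open>L\<^sup>1 \<inter> L\<^sup>\<alpha>\<close>\<close>

text \<open>The indicator is essential, because \<open>powr\<close> at a negative base is not 0.
  With it the fractional integral runs over the whole line, in the form that Young's inequality
  above treats.\<close>

definition RL_kernel :: "real \<Rightarrow> real \<Rightarrow> real" where
  "RL_kernel d u = indicator {0<..} u * u powr (d - 1)"

lemma RL_kernel_measurable [measurable]: "RL_kernel d \<in> borel_measurable borel"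
  unfolding RL_kernel_def by measurable

lemma RL_integral_eq_kernel:
  "RL_integral d g x = 1 / Gamma d * (LINT t|lborel. RL_kernel d (t - x) * g t)"
  unfolding RL_integral_def set_lebesgue_integral_def RL_kernel_def
  by (intro arg_cong2[where f="(*)"] Bochner_Integration.integral_cong refl)
     (auto simp: indicator_def)

lemma integrable_powr_from_0:
  fixes a c :: real
  assumes "- 1 < a" "0 \<le> c"
  shows "integrable lborel (\<lambda>u. indicator {0<..c} u * u powr a)"
    and "(LINT u|lborel. indicator {0<..c} u * u powr a) = c powr (a + 1) / (a + 1)"
proof -
  have "(\<integral>\<^sup>+u. ennreal (indicator {0<..c} u * u powr a) \<partial>lborel)
      = (\<integral>\<^sup>+u. ennreal (indicator {0..c} u * u powr a) \<partial>lborel)"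
    by (intro nn_integral_cong) (auto simp: indicator_def)
  also have "\<dots> = ennreal (c powr (a + 1) / (a + 1))"
    using nn_integral_has_integral_lebesgue[OF _ has_integral_powr_from_0[OF assms]] by simp
  finally have *: "(\<integral>\<^sup>+u. ennreal (indicator {0<..c} u * u powr a) \<partial>lborel)
      = ennreal (c powr (a + 1) / (a + 1))" .
  have "has_bochner_integral lborel (\<lambda>u. indicator {0<..c} u * u powr a) (c powr (a + 1) / (a + 1))"
    by (rule has_bochner_integral_nn_integral) (use assms * in auto)
  then show "integrable lborel (\<lambda>u. indicator {0<..c} u * u powr a)"
    "(LINT u|lborel. indicator {0<..c} u * u powr a) = c powr (a + 1) / (a + 1)"
    by (auto simp: has_bochner_integral_iff)
qed

lemma integrable_powr_to_inf:
  fixes a c :: real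
  assumes "a < - 1" "0 < c"
  shows "integrable lborel (\<lambda>u. indicator {c<..} u * u powr a)"
proof -
  have "(\<integral>\<^sup>+u. ennreal (indicator {c..} u * u powr a) \<partial>lborel) = ennreal (- (c powr (a + 1)) / (a + 1))"
    using nn_integral_has_integral_lebesgue[OF _ has_integral_powr_to_inf[OF assms]] by simp
  then have "integrable lborel (\<lambda>u. indicator {c..} u * u powr a)"
    by (intro integrableI_nonneg) auto
  then show ?thesis
    by (rule Bochner_Integration.integrable_bound) (auto simp: indicator_def)
qed

text \<open>The first bound is what makes the power \<alpha> of the kernel u^(d - 1) integrable at
  infinity.\<close>

lemma RL_exponent_bounds:
  fixes d \<alpha> :: real
  assumes "1 < \<alpha>" "d < 1 - 1 / \<alpha>"
  shows "(d - 1) * \<alpha> < - 1" "d < 1"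
proof -
  have "(1 - d) * \<alpha> > 1 / \<alpha> * \<alpha>"
    using assms by (intro mult_strict_right_mono) auto
  then show "(d - 1) * \<alpha> < - 1" using assms by (simp add: algebra_simps)
  have "1 / \<alpha> > 0" using assms by simp
  then show "d < 1" using assms by linarith
qed

text \<open>Young's inequality for the kernel split at distance 1: the singular part is in \<open>L\<^sup>1\<close> because
  \<open>0 < d\<close>, the tail is in \<open>L\<^sup>\<alpha>\<close> because \<open>d < 1 - 1 / \<alpha>\<close>.\<close>

lemma RL_integral_bound:
  assumes \<alpha>: "1 < \<alpha>" and d: "0 < d" "d < 1 - 1 / \<alpha>"
  shows "\<exists>C\<ge>0. \<forall>g. g \<in> Lp_space lborel 1 \<inter> Lp_space lborel \<alpha> \<longrightarrow>
    (AE x in lborel. integrable lborel (\<lambda>t. RL_kernel d (t - x) * g t)) \<and>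
    RL_integral d g \<in> Lp_space lborel \<alpha> \<and>
    (LINT x|lborel. \<bar>RL_integral d g x\<bar> powr \<alpha>)
      \<le> C * ((LINT x|lborel. \<bar>g x\<bar> powr \<alpha>) + (LINT x|lborel. \<bar>g x\<bar>) powr \<alpha>)"
proof -
  note e = RL_exponent_bounds[OF \<alpha> d(2)]
  define K1 K2 :: "real \<Rightarrow> real"
    where "K1 = (\<lambda>u. indicator {0<..1} u * u powr (d - 1))"
      and "K2 = (\<lambda>u. indicator {1<..} u * u powr (d - 1))"
  have K1: "integrable lborel K1" "\<And>u. 0 \<le> K1 u"
    unfolding K1_def using integrable_powr_from_0(1)[of "d - 1" 1] d by auto
  have "(\<lambda>u. \<bar>K2 u\<bar> powr \<alpha>) = (\<lambda>u. indicator {1<..} u * u powr ((d - 1) * \<alpha>))"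
    by (auto simp: K2_def indicator_def powr_powr)
  then have K2: "K2 \<in> Lp_space lborel \<alpha>" "\<And>u. 0 \<le> K2 u"
    using integrable_powr_to_inf[OF e(1), of 1] by (auto simp: Lp_space_iff K2_def)
  have K12: "RL_kernel d u = K1 u + K2 u" for u
    by (auto simp: K1_def K2_def RL_kernel_def indicator_def)
  define C1 C2 where "C1 = (LINT t|lborel. K1 t) powr \<alpha>" and "C2 = (LINT t|lborel. K2 t powr \<alpha>)"
  have C12: "0 \<le> C1" "0 \<le> C2" by (auto simp: C1_def C2_def)
  \<comment> \<open>The power \<alpha> of the factor \<open>1 / Gamma d\<close>, times the constant
    of \<open>powr_add_le\<close> for joining the two parts of the kernel.\<close>
  define c where "c = \<bar>1 / Gamma d\<bar> powr \<alpha> * 2 powr \<alpha>"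
  have c: "0 \<le> c" by (simp add: c_def)
  show ?thesis
  proof (intro exI[of _ "c * (C1 + C2)"] conjI allI impI)
    show "0 \<le> c * (C1 + C2)" using c C12 by simp
    fix g :: "real \<Rightarrow> real" assume g: "g \<in> Lp_space lborel 1 \<inter> Lp_space lborel \<alpha>"
    then have ga: "g \<in> Lp_space lborel \<alpha>" and "integrable lborel (\<lambda>x. \<bar>g x\<bar>)"
      by (auto simp: Lp_space_iff)
    then have g1: "integrable lborel g"
      by (subst (asm) integrable_abs_iff) (auto simp: Lp_space_iff)
    have [measurable]: "g \<in> borel_measurable borel" "K1 \<in> borel_measurable borel" "K2 \<in> borel_measurable borel"
      using ga by (auto simp: Lp_space_iff K1_def K2_def)
    have RLm[measurable]: "RL_integral d g \<in> borel_measurable lborel"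
      unfolding RL_integral_eq_kernel by measurable
    note Y1 = young_kernel_L1[OF \<alpha> K1 ga] and Y2 = young_kernel_Lp[OF \<alpha> K2 g1]
    have int: "AE x in lborel. integrable lborel (\<lambda>t. RL_kernel d (t - x) * \<bar>g t\<bar>) \<and>
      (LINT t|lborel. RL_kernel d (t - x) * \<bar>g t\<bar>) =
        (LINT t|lborel. K1 (t - x) * \<bar>g t\<bar>) + (LINT t|lborel. K2 (t - x) * \<bar>g t\<bar>)"
      using Y1(1) Y2(1) by eventually_elim (simp add: K12 distrib_right)
    have kn: "0 \<le> RL_kernel d u" for u by (simp add: RL_kernel_def)
    \<comment> \<open>Recorded along with the norm bound because additivity of
      \<open>RL_integral\<close> at x rests on it: where integrability fails, the integral takes the
      default value 0.\<close>
    show int': "AE x in lborel. integrable lborel (\<lambda>t. RL_kernel d (t - x) * g t)"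
      using int
    proof eventually_elim
      case (elim x)
      then have "integrable lborel (\<lambda>t. \<bar>RL_kernel d (t - x) * g t\<bar>)"
        using kn by (simp add: abs_mult)
      then show ?case
        by (subst (asm) integrable_abs_iff) measurable
    qed
    let ?F = "\<lambda>x. c * ((LINT t|lborel. K1 (t - x) * \<bar>g t\<bar>) powr \<alpha> + (LINT t|lborel. K2 (t - x) * \<bar>g t\<bar>) powr \<alpha>)"
    have bd: "AE x in lborel. \<bar>RL_integral d g x\<bar> powr \<alpha> \<le> ?F x"
      using int
    proof eventually_elim
      case (elim x)
      have "\<bar>LINT t|lborel. RL_kernel d (t - x) * g t\<bar> \<le> (LINT t|lborel. \<bar>RL_kernel d (t - x) * g t\<bar>)"
        by (rule integral_abs_bound)
      also have "\<dots> = \<bar>(LINT t|lborel. K1 (t - x) * \<bar>g t\<bar>) + (LINT t|lborel. K2 (t - x) * \<bar>g t\<bar>)\<bar>"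
        using elim kn K1(2) K2(2) by (simp add: abs_mult)
      finally have "\<bar>LINT t|lborel. RL_kernel d (t - x) * g t\<bar> powr \<alpha> \<le> \<dots> powr \<alpha>"
        using \<alpha> by (intro powr_mono2) auto
      also have "\<dots> \<le> 2 powr \<alpha> * ((LINT t|lborel. K1 (t - x) * \<bar>g t\<bar>) powr \<alpha> + (LINT t|lborel. K2 (t - x) * \<bar>g t\<bar>) powr \<alpha>)"
        using powr_add_le[of \<alpha> "LINT t|lborel. K1 (t - x) * \<bar>g t\<bar>" "LINT t|lborel. K2 (t - x) * \<bar>g t\<bar>"] \<alpha> K1(2) K2(2)
        by simp
      finally have "\<bar>1 / Gamma d\<bar> powr \<alpha> * \<bar>LINT t|lborel. RL_kernel d (t - x) * g t\<bar> powr \<alpha> \<le> \<bar>1 / Gamma d\<bar> powr \<alpha> * \<dots>"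
        by (rule mult_left_mono) simp
      then show ?case
        by (simp only: RL_integral_eq_kernel c_def abs_mult powr_mult abs_ge_zero mult.assoc)
    qed
    have intF: "integrable lborel ?F"
      using Y1(2) Y2(2) by (intro integrable_mult_right Bochner_Integration.integrable_add)
    have intR: "integrable lborel (\<lambda>x. \<bar>RL_integral d g x\<bar> powr \<alpha>)"
      by (rule Bochner_Integration.integrable_bound[OF intF]) (use bd in \<open>measurable, eventually_elim, auto\<close>)
    then show "RL_integral d g \<in> Lp_space lborel \<alpha>"
      by (simp add: Lp_space_iff)
    have "(LINT x|lborel. \<bar>RL_integral d g x\<bar> powr \<alpha>) \<le> (LINT x|lborel. ?F x)"
      by (rule integral_mono_AE[OF intR intF bd])
    also have "\<dots> = c * ((LINT x|lborel. (LINT t|lborel. K1 (t - x) * \<bar>g t\<bar>) powr \<alpha>)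
        + (LINT x|lborel. (LINT t|lborel. K2 (t - x) * \<bar>g t\<bar>) powr \<alpha>))"
      using Y1(2) Y2(2) by simp
    also have "\<dots> \<le> c * (C1 * (LINT x|lborel. \<bar>g x\<bar> powr \<alpha>) + C2 * (LINT x|lborel. \<bar>g x\<bar>) powr \<alpha>)"
      using Y1(3) Y2(3) unfolding C1_def C2_def by (intro mult_left_mono[OF _ c] add_mono)
    \<comment> \<open>Both terms get the factor C1 + C2, so that one constant independent of g
      remains.\<close>
    also have "\<dots> \<le> c * ((C1 + C2) * (LINT x|lborel. \<bar>g x\<bar> powr \<alpha>) + (C1 + C2) * (LINT x|lborel. \<bar>g x\<bar>) powr \<alpha>)"
      using C12 by (intro mult_left_mono[OF _ c] add_mono mult_right_mono) auto
    finally show "(LINT x|lborel. \<bar>RL_integral d g x\<bar> powr \<alpha>)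
      \<le> c * (C1 + C2) * ((LINT x|lborel. \<bar>g x\<bar> powr \<alpha>) + (LINT x|lborel. \<bar>g x\<bar>) powr \<alpha>)"
      by (simp add: algebra_simps)
  qed
qed

lemma RL_integral_in_Lp:
  assumes "1 < \<alpha>" "0 < d" "d < 1 - 1 / \<alpha>" "g \<in> Lp_space lborel 1 \<inter> Lp_space lborel \<alpha>"
  shows "RL_integral d g \<in> Lp_space lborel \<alpha>"
  using RL_integral_bound[OF assms(1-3)] assms(4) by blast

lemma RL_integral_lincomb_AE:
  assumes A: "1 < \<alpha>" "0 < d" "d < 1 - 1 / \<alpha>"
    and f: "f \<in> Lp_space lborel 1 \<inter> Lp_space lborel \<alpha>" and g: "g \<in> Lp_space lborel 1 \<inter> Lp_space lborel \<alpha>"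
  shows "AE x in lborel. RL_integral d (\<lambda>x. a * f x + b * g x) x = a * RL_integral d f x + b * RL_integral d g x"
proof -
  have "AE x in lborel. integrable lborel (\<lambda>t. RL_kernel d (t - x) * f t)"
    "AE x in lborel. integrable lborel (\<lambda>t. RL_kernel d (t - x) * g t)"
    using RL_integral_bound[OF A] f g by blast+
  then show ?thesis
  proof eventually_elim
    case (elim x)
    have "(LINT t|lborel. RL_kernel d (t - x) * (a * f t + b * g t))
        = (LINT t|lborel. a * (RL_kernel d (t - x) * f t) + b * (RL_kernel d (t - x) * g t))"
      by (intro Bochner_Integration.integral_cong) (auto simp: algebra_simps)
    also have "\<dots> = a * (LINT t|lborel. RL_kernel d (t - x) * f t) + b * (LINT t|lborel. RL_kernel d (t - x) * g t)"
      using elim by simp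
    finally show ?case
      by (simp add: RL_integral_eq_kernel algebra_simps)
  qed
qed

lemma RL_integral_sum_AE:
  assumes A: "1 < \<alpha>" "0 < d" "d < 1 - 1 / \<alpha>"
    and "finite I" "\<And>i. i \<in> I \<Longrightarrow> f i \<in> Lp_space lborel 1 \<inter> Lp_space lborel \<alpha>"
  shows "AE x in lborel. RL_integral d (\<lambda>x. \<Sum>i\<in>I. c i * f i x) x = (\<Sum>i\<in>I. c i * RL_integral d (f i) x)"
  using assms(4,5)
proof (induction I)
  case empty
  then show ?case by (simp add: RL_integral_eq_kernel)
next
  case (insert i I)
  have "(\<lambda>x. \<Sum>i\<in>I. c i * f i x) \<in> Lp_space lborel 1 \<inter> Lp_space lborel \<alpha>"
    using insert A by (auto intro!: Lp_space_sum)
  then have "AE x in lborel. RL_integral d (\<lambda>x. c i * f i x + 1 * (\<Sum>i\<in>I. c i * f i x)) x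
      = c i * RL_integral d (f i) x + 1 * RL_integral d (\<lambda>x. \<Sum>i\<in>I. c i * f i x) x"
    using insert.prems by (intro RL_integral_lincomb_AE[OF A]) auto
  moreover have "AE x in lborel. RL_integral d (\<lambda>x. \<Sum>i\<in>I. c i * f i x) x = (\<Sum>i\<in>I. c i * RL_integral d (f i) x)"
    using insert by simp
  ultimately show ?case
    by eventually_elim (use insert.hyps in simp)
qed

text \<open>Origin of the kernel of the motion. To the right of x, \<open>{s<..t}\<close> is
  \<open>{x<..t}\<close> minus \<open>{x<..s}\<close>; by translation each piece gives (r - x)_+^d /
  d, and d * Gamma d is Gamma (d + 1). The identity holds at every x, so kernels and fractional
  integrals may be exchanged as functions.\<close>

lemma RL_integral_indicator:
  assumes d: "0 < d" and st: "s \<le> t"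
  shows "RL_integral d (indicator {s<..t}) x
    = 1 / Gamma (d + 1) * (max (t - x) 0 powr d - max (s - x) 0 powr d)"
proof -
  have *: "integrable lborel (\<lambda>u. indicator {x<..r} u * (u - x) powr (d - 1))"
    "(LINT u|lborel. indicator {x<..r} u * (u - x) powr (d - 1)) = max (r - x) 0 powr d / d" for r
  proof -
    have I: "integrable lborel (\<lambda>u. indicator {0<..max (r - x) 0} u * u powr (d - 1))"
      "(LINT u|lborel. indicator {0<..max (r - x) 0} u * u powr (d - 1)) = max (r - x) 0 powr d / d"
      using integrable_powr_from_0[of "d - 1" "max (r - x) 0"] d by auto
    have eq: "(\<lambda>u. indicator {0<..max (r - x) 0} (- x + 1 * u) * (- x + 1 * u) powr (d - 1))
        = (\<lambda>u. indicator {x<..r} u * (u - x) powr (d - 1))"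
      by (auto simp: indicator_def fun_eq_iff)
    show "integrable lborel (\<lambda>u. indicator {x<..r} u * (u - x) powr (d - 1))"
      using lborel_integrable_real_affine[OF I(1), of 1 "- x"] unfolding eq by simp
    show "(LINT u|lborel. indicator {x<..r} u * (u - x) powr (d - 1)) = max (r - x) 0 powr d / d"
      using lborel_integral_real_affine[of 1 "\<lambda>u. indicator {0<..max (r - x) 0} u * u powr (d - 1)" "- x"]
      unfolding eq I(2) by simp
  qed
  have "(LINT u|lborel. RL_kernel d (u - x) * indicator {s<..t} u)
      = (LINT u|lborel. indicator {x<..t} u * (u - x) powr (d - 1) - indicator {x<..s} u * (u - x) powr (d - 1))"
    using st by (intro Bochner_Integration.integral_cong refl) (auto simp: RL_kernel_def indicator_def)
  also have "\<dots> = (max (t - x) 0 powr d - max (s - x) 0 powr d) / d"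
    using * by (simp add: diff_divide_distrib)
  finally have "(LINT u|lborel. RL_kernel d (u - x) * indicator {s<..t} u)
    = (max (t - x) 0 powr d - max (s - x) 0 powr d) / d" .
  moreover have "Gamma (d + 1) = d * Gamma d"
    using d by (intro Gamma_plus1) (auto dest: nonpos_Ints_nonpos)
  ultimately show ?thesis by (simp add: RL_integral_eq_kernel)
qed

section \<open>Density of step functions\<close>

lemma indicator_Ioc_telescope:
  fixes t :: "nat \<Rightarrow> real"
  assumes "k \<le> m" "\<And>i j. k \<le> i \<Longrightarrow> i \<le> j \<Longrightarrow> j \<le> m \<Longrightarrow> t i \<le> t j"
  shows "(\<Sum>i=k..<m. indicator {t i<..t (Suc i)} x) = (indicator {t k<..t m} x :: real)"
  using assms
proof (induction m rule: dec_induct)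
  case base
  then show ?case by simp
next
  case (step m)
  have "(\<Sum>i=k..<Suc m. indicator {t i<..t (Suc i)} x :: real)
      = indicator {t k<..t m} x + indicator {t m<..t (Suc m)} x"
    using step by simp
  also have "\<dots> = indicator {t k<..t (Suc m)} x"
    using step.prems[of k m] step.prems[of m "Suc m"] step.hyps by (auto simp: indicator_def)
  finally show ?case .
qed

text \<open>The endpoints, sorted, form the common grid.\<close>

lemma step_function_sum_indicator:
  fixes l r c :: "'i \<Rightarrow> real"
  assumes J: "finite J" and lr: "\<And>j. j \<in> J \<Longrightarrow> l j \<le> r j"
  shows "step_function (\<lambda>x. \<Sum>j\<in>J. c j * indicator {l j<..r j} x)"
proof -
  define S where "S = l ` J \<union> r ` J"
  define n where "n = card S"
  \<comment> \<open>Representations count grid points from 1, lists count from 0.\<close>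
  define t where "t i = sorted_list_of_set S ! (i - 1)" for i
  have S: "finite S" using J by (simp add: S_def)
  have mono: "strict_mono_on {1..n} t"
  proof (rule strict_mono_onI)
    fix i j assume "i \<in> {1..n}" "j \<in> {1..n}" "i < j"
    then show "t i < t j"
      using strict_sorted_list_of_set[of S] S unfolding t_def n_def
      by (intro sorted_wrt_nth_less[of "(<)"]) auto
  qed
  then have less_iff: "t i < t j \<longleftrightarrow> i < j" and le_iff: "t i \<le> t j \<longleftrightarrow> i \<le> j"
    if "i \<in> {1..n}" "j \<in> {1..n}" for i j
    using that strict_mono_on_less[OF mono] strict_mono_on_less_eq[OF mono] by auto
  have grid: "\<exists>k\<in>{1..n}. y = t k" if "y \<in> S" for y
  proof -
    from that S have "y \<in> set (sorted_list_of_set S)" by simp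
    then obtain k where "k < length (sorted_list_of_set S)" "sorted_list_of_set S ! k = y"
      unfolding in_set_conv_nth by blast
    then have "k < n" "y = sorted_list_of_set S ! k" by (simp_all add: n_def)
    then show ?thesis by (intro bexI[of _ "Suc k"]) (auto simp: t_def)
  qed
  \<comment> \<open>The sum is constant on each cell \<open>{t i<..t (Suc i)}\<close>, which
    contains its right end but not its left; hence the value at the right end is the
    coefficient.\<close>
  define a where "a i = (\<Sum>j\<in>J. c j * indicator {l j<..r j} (t (Suc i)))" for i
  have split: "(\<Sum>i=1..<n. indicator {l j<..r j} (t (Suc i)) * indicator {t i<..t (Suc i)} x)
      = (indicator {l j<..r j} x :: real)" if "j \<in> J" for j x
  proof -
    have "l j \<in> S" "r j \<in> S" using that by (auto simp: S_def)
    then obtain k m where km: "k \<in> {1..n}" "m \<in> {1..n}" "l j = t k" "r j = t m"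
      using grid by meson
    have "k \<le> m" using lr[OF that] km le_iff by auto
    \<comment> \<open>The right end \<open>t (Suc i)\<close> lies in \<open>{t k<..t m}\<close>
      exactly when k \<le> i < m; the remaining cells telescope.\<close>
    have "(\<Sum>i=1..<n. indicator {l j<..r j} (t (Suc i)) * indicator {t i<..t (Suc i)} x)
        = (\<Sum>i=1..<n. if i \<in> {k..<m} then indicator {t i<..t (Suc i)} x else 0 :: real)"
      using km by (intro sum.cong) (auto simp: indicator_def less_iff le_iff)
    also have "\<dots> = (\<Sum>i=k..<m. indicator {t i<..t (Suc i)} x)"
      using km by (subst sum.inter_restrict[symmetric]) (auto intro!: sum.cong)
    also have "\<dots> = indicator {t k<..t m} x"
      using km by (intro indicator_Ioc_telescope \<open>k \<le> m\<close>) (auto simp: le_iff)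
    finally show ?thesis using km by simp
  qed
  have "(\<Sum>j\<in>J. c j * indicator {l j<..r j} x) = (\<Sum>i=1..<n. a i * indicator {t i<..t (Suc i)} x)" for x
  proof -
    have "(\<Sum>j\<in>J. c j * indicator {l j<..r j} x)
        = (\<Sum>j\<in>J. \<Sum>i=1..<n. c j * (indicator {l j<..r j} (t (Suc i)) * indicator {t i<..t (Suc i)} x))"
      using split by (intro sum.cong refl) (simp flip: sum_distrib_left)
    also have "\<dots> = (\<Sum>i=1..<n. a i * indicator {t i<..t (Suc i)} x)"
      unfolding a_def sum_distrib_right by (subst sum.swap) (simp add: mult.assoc)
    finally show ?thesis .
  qed
  then have "step_repr (\<lambda>x. \<Sum>j\<in>J. c j * indicator {l j<..r j} x) n a t"
    using mono by (simp add: step_repr_def)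
  then show ?thesis unfolding step_function_def by blast
qed

lemma step_reprD:
  assumes "step_repr \<phi> n a t"
  shows "\<phi> = (\<lambda>x. \<Sum>i\<in>{1..<n}. a i * indicator {t i<..t (Suc i)} x)"
    and "\<And>i. i \<in> {1..<n} \<Longrightarrow> t i \<le> t (Suc i)"
proof -
  show "t i \<le> t (Suc i)" if "i \<in> {1..<n}" for i
  proof -
    have "i \<in> {1..n}" "Suc i \<in> {1..n}" using that by auto
    then show ?thesis
      using assms strict_mono_onD[of "{1..n}" t i "Suc i"] by (auto simp: step_repr_def)
  qed
qed (use assms in \<open>simp add: step_repr_def\<close>)

text \<open>The two representations are merely concatenated over a disjoint sum of index sets:
  \<open>step_function_sum_indicator\<close> allows overlapping intervals and does the
  refinement.\<close>

lemma step_function_lincomb: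
  assumes "step_function \<phi>" "step_function \<psi>"
  shows "step_function (\<lambda>x. a * \<phi> x + b * \<psi> x)"
proof -
  obtain n c t m e s where r: "step_repr \<phi> n c t" "step_repr \<psi> m e s"
    using assms by (auto simp: step_function_def)
  have "step_function (\<lambda>x. \<Sum>j\<in>{1..<n} <+> {1..<m}.
      case_sum (\<lambda>i. a * c i) (\<lambda>i. b * e i) j
        * indicator {case_sum t s j<..case_sum (\<lambda>i. t (Suc i)) (\<lambda>i. s (Suc i)) j} x)"
    using step_reprD(2)[OF r(1)] step_reprD(2)[OF r(2)] by (intro step_function_sum_indicator) auto
  also have "(\<lambda>x. \<Sum>j\<in>{1..<n} <+> {1..<m}.
      case_sum (\<lambda>i. a * c i) (\<lambda>i. b * e i) j
        * indicator {case_sum t s j<..case_sum (\<lambda>i. t (Suc i)) (\<lambda>i. s (Suc i)) j} x)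
     = (\<lambda>x. a * \<phi> x + b * \<psi> x)"
    by (subst step_reprD(1)[OF r(1)], subst step_reprD(1)[OF r(2)])
       (simp only: sum.Plus finite_atLeastLessThan sum_distrib_left mult.assoc o_def sum.case)
  finally show ?thesis .
qed

lemma step_function_indicator:
  "l \<le> r \<Longrightarrow> step_function (indicator {l<..r})"
  using step_function_sum_indicator[of "{()}" "\<lambda>_. l" "\<lambda>_. r" "\<lambda>_. 1"] by simp

lemma step_function_in_Lp:
  assumes "step_function \<phi>" "0 \<le> p"
  shows "\<phi> \<in> Lp_space lborel p"
proof -
  obtain n a t where r: "step_repr \<phi> n a t"
    using assms by (auto simp: step_function_def)
  have "(indicator {t i<..t (Suc i)} :: real \<Rightarrow> real) \<in> Lp_space lborel p" if "i \<in> {1..<n}" for i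
    using step_reprD(2)[OF r that] by (intro indicator_in_Lp_space) auto
  then show ?thesis
    by (subst step_reprD(1)[OF r]) (intro Lp_space_sum assms, auto)
qed

section \<open>The closure of the step functions in L^1 \<inter> L^p\<close>

definition L1p_modulus :: "real \<Rightarrow> (real \<Rightarrow> real) \<Rightarrow> real" where
  "L1p_modulus p h = (LINT x|lborel. \<bar>h x\<bar>) + (LINT x|lborel. \<bar>h x\<bar> powr p)"

text \<open>Membership in the closure, with integrability built in so that the closure properties
  compose: linear combinations and dominated limits lead from intervals to Borel sets, simple
  functions and finally the whole space.\<close>

definition step_approximable :: "real \<Rightarrow> (real \<Rightarrow> real) \<Rightarrow> bool" where
  "step_approximable p g \<longleftrightarrow> g \<in> Lp_space lborel 1 \<inter> Lp_space lborel p \<and>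
    (\<exists>\<phi>. (\<forall>n::nat. step_function (\<phi> n)) \<and> (\<lambda>n. L1p_modulus p (\<lambda>x. \<phi> n x - g x)) \<longlonglongrightarrow> 0)"

lemma L1p_modulus_nonneg: "0 \<le> L1p_modulus p h"
  by (simp add: L1p_modulus_def)

text \<open>The modulus adds integrals without taking roots, so it is not a norm. A factor depending
  only on a, b and p takes the place of homogeneity and the triangle inequality and suffices for
  convergence to 0.\<close>

lemma L1p_modulus_lincomb:
  assumes p: "0 \<le> p" and f: "f \<in> Lp_space lborel 1 \<inter> Lp_space lborel p"
    and g: "g \<in> Lp_space lborel 1 \<inter> Lp_space lborel p"
  shows "L1p_modulus p (\<lambda>x. a * f x + b * g x)
    \<le> (\<bar>a\<bar> + \<bar>b\<bar> + 2 powr p * (\<bar>a\<bar> powr p + \<bar>b\<bar> powr p)) * (L1p_modulus p f + L1p_modulus p g)"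
proof -
  define If Ig where "If = (LINT x|lborel. \<bar>f x\<bar>)" and "Ig = (LINT x|lborel. \<bar>g x\<bar>)"
  define Jf Jg where "Jf = (LINT x|lborel. \<bar>f x\<bar> powr p)" and "Jg = (LINT x|lborel. \<bar>g x\<bar> powr p)"
  have nn: "0 \<le> If" "0 \<le> Ig" "0 \<le> Jf" "0 \<le> Jg"
    by (simp_all add: If_def Ig_def Jf_def Jg_def)
  have int: "integrable lborel (\<lambda>x. \<bar>f x\<bar>)" "integrable lborel (\<lambda>x. \<bar>g x\<bar>)"
    "integrable lborel (\<lambda>x. \<bar>f x\<bar> powr p)" "integrable lborel (\<lambda>x. \<bar>g x\<bar> powr p)"
    using f g by (auto simp: Lp_space_iff)
  have comb: "(\<lambda>x. a * f x + b * g x) \<in> Lp_space lborel 1 \<inter> Lp_space lborel p"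
    using f g p by (auto intro: Lp_space_lincomb)
  then have intc: "integrable lborel (\<lambda>x. \<bar>a * f x + b * g x\<bar>)"
      "integrable lborel (\<lambda>x. \<bar>a * f x + b * g x\<bar> powr p)"
    by (auto simp: Lp_space_iff)
  have "(LINT x|lborel. \<bar>a * f x + b * g x\<bar>) \<le> (LINT x|lborel. \<bar>a\<bar> * \<bar>f x\<bar> + \<bar>b\<bar> * \<bar>g x\<bar>)"
    using int intc abs_triangle_ineq[of "a * f _" "b * g _"] by (intro integral_mono) (auto simp: abs_mult)
  also have "\<dots> = \<bar>a\<bar> * If + \<bar>b\<bar> * Ig"
    using int by (simp add: If_def Ig_def)
  also have "\<dots> \<le> (\<bar>a\<bar> + \<bar>b\<bar>) * (If + Ig)"
    using nn by (simp add: algebra_simps)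
  finally have 1: "(LINT x|lborel. \<bar>a * f x + b * g x\<bar>) \<le> (\<bar>a\<bar> + \<bar>b\<bar>) * (If + Ig)" .
  have "(LINT x|lborel. \<bar>a * f x + b * g x\<bar> powr p)
      \<le> (LINT x|lborel. 2 powr p * (\<bar>a\<bar> powr p * \<bar>f x\<bar> powr p + \<bar>b\<bar> powr p * \<bar>g x\<bar> powr p))"
    using int intc powr_add_le[OF p, of "a * f _" "b * g _"]
    by (intro integral_mono) (auto simp: abs_mult powr_mult)
  also have "\<dots> = 2 powr p * (\<bar>a\<bar> powr p * Jf + \<bar>b\<bar> powr p * Jg)"
    using int by (simp add: Jf_def Jg_def)
  also have "\<dots> \<le> 2 powr p * ((\<bar>a\<bar> powr p + \<bar>b\<bar> powr p) * (Jf + Jg))"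
    using nn by (intro mult_left_mono) (auto simp: algebra_simps)
  finally have 2: "(LINT x|lborel. \<bar>a * f x + b * g x\<bar> powr p)
      \<le> 2 powr p * (\<bar>a\<bar> powr p + \<bar>b\<bar> powr p) * (Jf + Jg)" by (simp add: mult.assoc)
  define A B where "A = \<bar>a\<bar> + \<bar>b\<bar>" and "B = 2 powr p * (\<bar>a\<bar> powr p + \<bar>b\<bar> powr p)"
  have "0 \<le> A" "0 \<le> B" by (auto simp: A_def B_def)
  then have "A * (If + Ig) + B * (Jf + Jg) \<le> (A + B) * (If + Ig + (Jf + Jg))"
    using nn by (simp add: algebra_simps)
  then show ?thesis
    using 1 2 unfolding L1p_modulus_def If_def[symmetric] Ig_def[symmetric] Jf_def[symmetric] Jg_def[symmetric]
      A_def B_def by (simp add: add_ac)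
qed

lemma step_approximable_step:
  assumes "step_function \<phi>" "0 \<le> p"
  shows "step_approximable p \<phi>"
  unfolding step_approximable_def
  using assms by (auto intro!: step_function_in_Lp exI[of _ "\<lambda>_. \<phi>"] simp: L1p_modulus_def)

lemma step_in_L1p:
  "0 \<le> p \<Longrightarrow> step_function \<phi> \<Longrightarrow> \<phi> \<in> Lp_space lborel 1 \<inter> Lp_space lborel p"
  by (simp add: step_function_in_Lp)

lemma L1p_diff:
  "0 \<le> p \<Longrightarrow> f \<in> Lp_space lborel 1 \<inter> Lp_space lborel p \<Longrightarrow> g \<in> Lp_space lborel 1 \<inter> Lp_space lborel p
    \<Longrightarrow> (\<lambda>x. f x - g x) \<in> Lp_space lborel 1 \<inter> Lp_space lborel p"
  by (auto intro!: Lp_space_diff)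

lemma step_approximable_lincomb:
  assumes p: "0 \<le> p" and f: "step_approximable p f" and g: "step_approximable p g"
  shows "step_approximable p (\<lambda>x. a * f x + b * g x)"
proof -
  obtain \<phi> \<psi> where \<phi>: "\<And>n. step_function (\<phi> n)" "(\<lambda>n. L1p_modulus p (\<lambda>x. \<phi> n x - f x)) \<longlonglongrightarrow> 0"
    and \<psi>: "\<And>n. step_function (\<psi> n)" "(\<lambda>n. L1p_modulus p (\<lambda>x. \<psi> n x - g x)) \<longlonglongrightarrow> 0"
    using f g by (auto simp: step_approximable_def)
  have fg: "f \<in> Lp_space lborel 1 \<inter> Lp_space lborel p" "g \<in> Lp_space lborel 1 \<inter> Lp_space lborel p"
    using f g by (auto simp: step_approximable_def)
  define C where "C = \<bar>a\<bar> + \<bar>b\<bar> + 2 powr p * (\<bar>a\<bar> powr p + \<bar>b\<bar> powr p)"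
  have "(\<lambda>n. L1p_modulus p (\<lambda>x. (a * \<phi> n x + b * \<psi> n x) - (a * f x + b * g x))) \<longlonglongrightarrow> 0"
  proof (rule tendsto_sandwich[OF _ _ tendsto_const])
    show "(\<lambda>n. C * (L1p_modulus p (\<lambda>x. \<phi> n x - f x) + L1p_modulus p (\<lambda>x. \<psi> n x - g x))) \<longlonglongrightarrow> 0"
      using \<phi>(2) \<psi>(2) by (auto intro!: tendsto_eq_intros)
    have "L1p_modulus p (\<lambda>x. (a * \<phi> n x + b * \<psi> n x) - (a * f x + b * g x))
        \<le> C * (L1p_modulus p (\<lambda>x. \<phi> n x - f x) + L1p_modulus p (\<lambda>x. \<psi> n x - g x))" for n
      using L1p_modulus_lincomb[OF p L1p_diff[OF p step_in_L1p[OF p \<phi>(1)[of n]] fg(1)]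
          L1p_diff[OF p step_in_L1p[OF p \<psi>(1)[of n]] fg(2)], of a b]
      by (simp add: C_def algebra_simps)
    then show "\<forall>\<^sub>F n in sequentially. L1p_modulus p (\<lambda>x. (a * \<phi> n x + b * \<psi> n x) - (a * f x + b * g x))
        \<le> C * (L1p_modulus p (\<lambda>x. \<phi> n x - f x) + L1p_modulus p (\<lambda>x. \<psi> n x - g x))" by simp
  qed (simp add: L1p_modulus_nonneg)
  moreover have "step_function (\<lambda>x. a * \<phi> n x + b * \<psi> n x)" for n
    by (intro step_function_lincomb \<phi> \<psi>)
  moreover have "(\<lambda>x. a * f x + b * g x) \<in> Lp_space lborel 1 \<inter> Lp_space lborel p"
    using fg p by (auto intro!: Lp_space_lincomb)
  ultimately show ?thesis
    unfolding step_approximable_def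
    by (intro conjI exI[of _ "\<lambda>n x. a * \<phi> n x + b * \<psi> n x"]) auto
qed

lemma step_approximable_0: "0 \<le> p \<Longrightarrow> step_approximable p (\<lambda>x. 0)"
  using step_approximable_step[OF step_function_indicator[of 0 0]] by (simp add: indicator_def[abs_def])

lemma step_approximable_sum:
  assumes "0 \<le> p" "finite A" "\<And>i. i \<in> A \<Longrightarrow> step_approximable p (f i)"
  shows "step_approximable p (\<lambda>x. \<Sum>i\<in>A. c i * f i x)"
  using assms(2,3)
proof (induction A)
  case empty
  then show ?case by (simp add: step_approximable_0 assms)
next
  case (insert i A)
  then show ?case
    using step_approximable_lincomb[OF \<open>0 \<le> p\<close>, of "f i" "\<lambda>x. \<Sum>i\<in>A. c i * f i x" "c i" 1] by simp
qed

text \<open>Dominated convergence for both integrals. The limit inherits the bound w, so the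
  differences are bounded by 2 * w and their powers by \<open>2 powr p * w powr p\<close>.\<close>

lemma L1p_modulus_dominated:
  assumes p: "0 < p" and w: "w \<in> Lp_space lborel 1 \<inter> Lp_space lborel p"
    and s: "\<And>n::nat. s n \<in> borel_measurable borel" and g: "g \<in> borel_measurable borel"
    and lim: "\<And>x. (\<lambda>n. s n x) \<longlonglongrightarrow> g x" and dom: "\<And>n x. \<bar>s n x\<bar> \<le> w x"
  shows "(\<lambda>n. L1p_modulus p (\<lambda>x. s n x - g x)) \<longlonglongrightarrow> 0"
    and "g \<in> Lp_space lborel 1 \<inter> Lp_space lborel p"
proof -
  note [measurable] = s g
  have domg: "\<bar>g x\<bar> \<le> w x" for x
    by (rule LIMSEQ_le_const2[OF tendsto_rabs[OF lim]]) (auto simp: dom)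
  have nn: "0 \<le> w x" for x using dom[of undefined x] by linarith
  have w': "integrable lborel w" "integrable lborel (\<lambda>x. w x powr p)"
    using w nn by (auto simp: Lp_space_iff)
  have "integrable lborel (\<lambda>x. \<bar>g x\<bar>)"
    by (rule Bochner_Integration.integrable_bound[OF w'(1)]) (use domg nn in auto)
  moreover have "integrable lborel (\<lambda>x. \<bar>g x\<bar> powr p)"
    by (rule Bochner_Integration.integrable_bound[OF w'(2)])
       (use domg nn p in \<open>auto intro!: powr_mono2\<close>)
  ultimately show "g \<in> Lp_space lborel 1 \<inter> Lp_space lborel p"
    by (simp add: Lp_space_iff)
  have le: "\<bar>s n x - g x\<bar> \<le> 2 * w x" for n x
    using dom[of n x] domg[of x] by linarith
  have d0: "(\<lambda>n. \<bar>s n x - g x\<bar>) \<longlonglongrightarrow> 0" for x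
    using lim[of x] by (simp add: LIM_zero tendsto_rabs_zero)
  have "(\<lambda>n. LINT x|lborel. \<bar>s n x - g x\<bar>) \<longlonglongrightarrow> integral\<^sup>L lborel (\<lambda>x::real. 0::real)"
    by (rule integral_dominated_convergence[where w="\<lambda>x. 2 * w x"])
       (use w' le d0 in auto)
  moreover have "(\<lambda>n. LINT x|lborel. \<bar>s n x - g x\<bar> powr p) \<longlonglongrightarrow> integral\<^sup>L lborel (\<lambda>x::real. 0::real)"
  proof (rule integral_dominated_convergence[where w="\<lambda>x. 2 powr p * w x powr p"])
    show "AE x in lborel. (\<lambda>n. \<bar>s n x - g x\<bar> powr p) \<longlonglongrightarrow> 0"
      using d0 p by (auto intro!: AE_I2 tendsto_zero_powrI tendsto_const)
    show "AE x in lborel. norm (\<bar>s n x - g x\<bar> powr p) \<le> 2 powr p * w x powr p" for n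
      using powr_mono2[OF _ _ le, of p n] p nn by (auto simp: powr_mult)
  qed (use w' in auto)
  ultimately have "(\<lambda>n. (LINT x|lborel. \<bar>s n x - g x\<bar>) + (LINT x|lborel. \<bar>s n x - g x\<bar> powr p)) \<longlonglongrightarrow> 0 + 0"
    by (intro tendsto_add) simp_all
  then show "(\<lambda>n. L1p_modulus p (\<lambda>x. s n x - g x)) \<longlonglongrightarrow> 0"
    by (simp add: L1p_modulus_def)
qed

text \<open>A diagonal choice: a step function within 1 / (n + 1) of \<open>s n\<close>, compared
  with g through the quasi-triangle inequality for a = b = 1.\<close>

lemma step_approximable_limit:
  assumes p: "0 \<le> p" and s: "\<And>n::nat. step_approximable p (s n)"
    and g: "g \<in> Lp_space lborel 1 \<inter> Lp_space lborel p"
    and lim: "(\<lambda>n. L1p_modulus p (\<lambda>x. s n x - g x)) \<longlonglongrightarrow> 0"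
  shows "step_approximable p g"
proof -
  have sL: "s n \<in> Lp_space lborel 1 \<inter> Lp_space lborel p" for n
    using s by (simp add: step_approximable_def)
  have "\<exists>\<phi>. step_function \<phi> \<and> L1p_modulus p (\<lambda>x. \<phi> x - s n x) < inverse (real (Suc n))" for n
  proof -
    obtain \<phi> where \<phi>: "\<And>k::nat. step_function (\<phi> k)" "(\<lambda>k. L1p_modulus p (\<lambda>x. \<phi> k x - s n x)) \<longlonglongrightarrow> 0"
      using s[of n] by (auto simp: step_approximable_def)
    from order_tendstoD(2)[OF \<phi>(2), of "inverse (real (Suc n))"]
    obtain k where "L1p_modulus p (\<lambda>x. \<phi> k x - s n x) < inverse (real (Suc n))"
      by (auto simp: eventually_sequentially)
    then show ?thesis using \<phi>(1) by blast
  qed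
  then obtain \<phi> where \<phi>: "\<And>n. step_function (\<phi> n)"
      "\<And>n. L1p_modulus p (\<lambda>x. \<phi> n x - s n x) < inverse (real (Suc n))" by metis
  define C where "C = \<bar>1\<bar> + \<bar>1\<bar> + 2 powr p * (\<bar>1\<bar> powr p + \<bar>1\<bar> powr p)"
  have "(\<lambda>n. L1p_modulus p (\<lambda>x. \<phi> n x - g x)) \<longlonglongrightarrow> 0"
  proof (rule tendsto_sandwich[OF _ _ tendsto_const])
    show "(\<lambda>n. C * (inverse (real (Suc n)) + L1p_modulus p (\<lambda>x. s n x - g x))) \<longlonglongrightarrow> 0"
      using tendsto_mult[OF tendsto_const[of C] tendsto_add[OF LIMSEQ_inverse_real_of_nat lim]] by simp
    have "L1p_modulus p (\<lambda>x. \<phi> n x - g x)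
        \<le> C * (inverse (real (Suc n)) + L1p_modulus p (\<lambda>x. s n x - g x))" for n
    proof -
      have "L1p_modulus p (\<lambda>x. \<phi> n x - g x)
        \<le> C * (L1p_modulus p (\<lambda>x. \<phi> n x - s n x) + L1p_modulus p (\<lambda>x. s n x - g x))"
        using L1p_modulus_lincomb[OF p L1p_diff[OF p step_in_L1p[OF p \<phi>(1)[of n]] sL[of n]] L1p_diff[OF p sL[of n] g], of 1 1]
        by (simp add: C_def)
      also have "\<dots> \<le> C * (inverse (real (Suc n)) + L1p_modulus p (\<lambda>x. s n x - g x))"
        using \<phi>(2)[of n] by (intro mult_left_mono) (auto simp: C_def)
      finally show ?thesis .
    qed
    then show "\<forall>\<^sub>F n in sequentially. L1p_modulus p (\<lambda>x. \<phi> n x - g x)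
        \<le> C * (inverse (real (Suc n)) + L1p_modulus p (\<lambda>x. s n x - g x))" by simp
  qed (simp add: L1p_modulus_nonneg)
  then show ?thesis
    using g \<phi>(1) by (auto simp: step_approximable_def)
qed

lemma step_approximable_dominated:
  assumes p: "0 < p" and w: "w \<in> Lp_space lborel 1 \<inter> Lp_space lborel p"
    and s: "\<And>n::nat. step_approximable p (s n)" and g: "g \<in> borel_measurable borel"
    and lim: "\<And>x. (\<lambda>n. s n x) \<longlonglongrightarrow> g x" and dom: "\<And>n x. \<bar>s n x\<bar> \<le> w x"
  shows "step_approximable p g"
proof -
  have "s n \<in> borel_measurable borel" for n
    using s by (auto simp: step_approximable_def Lp_space_iff)
  note D = L1p_modulus_dominated[OF p w this g lim dom]
  show ?thesis
    using step_approximable_limit[OF _ s D(2,1)] p by simp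
qed

text \<open>Dynkin's argument on the intersection-stable half-open intervals. The window {-N<..N}
  keeps complements integrable and dominates the disjoint unions.\<close>

lemma step_approximable_indicator_bounded:
  fixes B :: "real set" and N :: real
  assumes p: "0 < p" and B: "B \<in> sets borel"
  shows "step_approximable p (indicator (B \<inter> {- N<..N}))"
proof -
  have gen: "B \<in> sigma_sets UNIV (range (\<lambda>(a, b). {a<..b::real}))"
    using B by (subst (asm) borel_sigma_sets_Ioc) simp
  have Ioc: "step_approximable p (indicator {a<..b})" for a b :: real
    using step_approximable_step[OF step_function_indicator[of a b]] step_approximable_0[of p] p
    by (cases "a \<le> b") (auto simp: indicator_def[abs_def])
  have Ii: "Int_stable (range (\<lambda>(a, b). {a<..b::real}))"
  proof (rule Int_stableI)
    fix A B :: "real set"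
    assume "A \<in> range (\<lambda>(a, b). {a<..b})" "B \<in> range (\<lambda>(a, b). {a<..b})"
    then obtain a b c e where "A = {a<..b}" "B = {c<..e}" by auto
    then have "A \<inter> B = (\<lambda>(a, b). {a<..b}) (max a c, min b e)" by auto
    then show "A \<inter> B \<in> range (\<lambda>(a, b). {a<..b})" by (rule range_eqI)
  qed
  have sub: "range (\<lambda>(a, b). {a<..b::real}) \<subseteq> Pow UNIV" by simp
  have borel: "A \<in> sets borel" if "A \<in> sigma_sets UNIV (range (\<lambda>(a, b). {a<..b::real}))" for A
    using that by (subst borel_sigma_sets_Ioc) simp
  show ?thesis
    using Ii sub gen
  proof (induction rule: sigma_sets_induct_disjoint)
    case (basic A)
    then obtain a b where "A = {a<..b}" by auto
    then have "A \<inter> {- N<..N} = {max a (- N)<..min b N}" by auto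
    then show ?case using Ioc by simp
  next
    case empty
    show ?case using step_approximable_0[of p] p by (simp add: indicator_def[abs_def])
  next
    case (compl A)
    have "indicator ((UNIV - A) \<inter> {- N<..N})
        = (\<lambda>x. 1 * indicator {- N<..N} x + (- 1) * indicator (A \<inter> {- N<..N}) x :: real)"
      by (auto simp: indicator_def)
    then show ?case
      using step_approximable_lincomb[OF less_imp_le[OF p] Ioc compl(2), of 1 "- N" N "- 1"] by simp
  next
    case (union A)
    have [measurable]: "A i \<in> sets borel" for i
      using union(2) by (intro borel) auto
    \<comment> \<open>By disjointness the partial sums are indicators of partial unions, so they
      never exceed the indicator of the window. The factor 1 fits the shape of
      \<open>step_approximable_sum\<close>.\<close>
    let ?s = "\<lambda>k x. \<Sum>i<k. 1 * indicator (A i \<inter> {- N<..N}) x :: real"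
    have eq: "?s k x = indicator ((\<Union>i<k. A i) \<inter> {- N<..N}) x" for k x
    proof -
      have "disjoint_family_on (\<lambda>i. A i \<inter> {- N<..N}) {..<k}"
        using union(1) by (auto simp: disjoint_family_on_def)
      then have "indicator (\<Union>i<k. A i \<inter> {- N<..N}) x = (\<Sum>i<k. indicator (A i \<inter> {- N<..N}) x :: real)"
        by (intro indicator_UN_disjoint) auto
      then show ?thesis by (simp add: Int_UN_distrib2)
    qed
    show ?case
    proof (rule step_approximable_dominated[OF p])
      show "(indicator {- N<..N} :: real \<Rightarrow> real) \<in> Lp_space lborel 1 \<inter> Lp_space lborel p"
        using Ioc by (simp add: step_approximable_def)
      show "step_approximable p (?s k)" for k
        using union(3) p by (intro step_approximable_sum) auto
      show "(\<lambda>k. ?s k x) \<longlonglongrightarrow> indicator ((\<Union>i. A i) \<inter> {- N<..N}) x" for x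
      proof -
        have "\<forall>\<^sub>F k in sequentially. indicator ((\<Union>i<k. A i) \<inter> {- N<..N}) x
            = (indicator ((\<Union>i. A i) \<inter> {- N<..N}) x :: real)"
        proof (cases "x \<in> (\<Union>i. A i)")
          case True
          then obtain j where "x \<in> A j" by blast
          then show ?thesis
            by (intro eventually_sequentiallyI[of "Suc j"]) (auto simp: indicator_def)
        next
          case False
          then show ?thesis by (auto simp: indicator_def)
        qed
        then show ?thesis unfolding eq by (rule tendsto_eventually)
      qed
      show "\<bar>?s k x\<bar> \<le> indicator {- N<..N} x" for k x
        unfolding eq by (simp add: indicator_def)
    qed measurable
  qed
qed

text \<open>The window grows to the whole line; A itself, of finite measure, supplies the dominating
  function.\<close>

lemma step_approximable_indicator:
  fixes A :: "real set"
  assumes p: "0 < p" and A: "A \<in> sets borel" "emeasure lborel A < \<infinity>"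
  shows "step_approximable p (indicator A)"
proof (rule step_approximable_dominated[OF p])
  show "(indicator A :: real \<Rightarrow> real) \<in> Lp_space lborel 1 \<inter> Lp_space lborel p"
    using A by (auto intro!: indicator_in_Lp_space)
  show "step_approximable p (indicator (A \<inter> {- real n<..real n}))" for n
    by (rule step_approximable_indicator_bounded[OF p A(1)])
  show "(\<lambda>n. indicator (A \<inter> {- real n<..real n}) x) \<longlonglongrightarrow> (indicator A x :: real)" for x
  proof (rule tendsto_eventually)
    obtain k where k: "\<bar>x\<bar> < real k" using reals_Archimedean2 by blast
    show "\<forall>\<^sub>F n in sequentially. indicator (A \<inter> {- real n<..real n}) x = (indicator A x :: real)"
      using k by (intro eventually_sequentiallyI[of k]) (auto simp: indicator_def)
  qed
  show "\<bar>indicator (A \<inter> {- real n<..real n}) x\<bar> \<le> (indicator A x :: real)" for n x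
    by (simp add: indicator_def)
qed (use A in measurable)

lemma step_approximable_L1p:
  assumes p: "0 < p" and g: "g \<in> Lp_space lborel 1 \<inter> Lp_space lborel p"
  shows "step_approximable p g"
proof -
  have gm[measurable]: "g \<in> borel_measurable lborel" using g by (simp add: Lp_space_iff)
  \<comment> \<open>The bound on the distance to 0 gives \<bar>F i\<bar> \<le> 2 * \<bar>g\<bar>,
    which is the dominating function below.\<close>
  obtain F where F: "\<And>i. simple_function lborel (F i)" "\<And>x. (\<lambda>i. F i x) \<longlonglongrightarrow> g x"
    "\<And>i x. dist (F i x) 0 \<le> 2 * dist (g x) 0"
    using borel_measurable_implies_sequence_metric[OF gm, of 0] by auto
  show ?thesis
  proof (rule step_approximable_dominated[OF p])
    have "(\<lambda>x. 2 * g x) \<in> Lp_space lborel 1 \<inter> Lp_space lborel p"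
      using g p by (auto intro: Lp_space_cmult)
    then show w: "(\<lambda>x. \<bar>2 * g x\<bar>) \<in> Lp_space lborel 1 \<inter> Lp_space lborel p"
      by (simp add: Lp_space_iff)
    show dom: "\<bar>F n x\<bar> \<le> \<bar>2 * g x\<bar>" for n x
      using F(3)[of n x] by (simp add: dist_norm)
    show "step_approximable p (F n)" for n
    proof -
      have [measurable]: "F n \<in> borel_measurable borel"
        using borel_measurable_simple_function[OF F(1)] by simp
      have fin: "finite (range (F n))" using simple_functionD(1)[OF F(1)[of n]] by simp
      have int: "integrable lborel (\<lambda>x. \<bar>F n x\<bar>)"
        by (rule Bochner_Integration.integrable_bound[of _ "\<lambda>x. \<bar>2 * g x\<bar>"]) (use w dom in \<open>auto simp: Lp_space_iff\<close>)
      \<comment> \<open>The value 0 is left out because its level set has infinite measure.\<close>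
      have "F n = (\<lambda>x. \<Sum>y\<in>range (F n) - {0}. y * indicator (F n -` {y}) x)"
      proof
        fix x
        have "(\<Sum>y\<in>range (F n) - {0}. y * indicator (F n -` {y}) x) = (\<Sum>y\<in>range (F n). y * indicator (F n -` {y}) x)"
          using fin by (intro sum.mono_neutral_left) auto
        also have "\<dots> = (\<Sum>y\<in>range (F n). if y = F n x then y else 0)"
          by (intro sum.cong) (auto simp: indicator_def)
        also have "\<dots> = F n x" using fin by simp
        finally show "F n x = (\<Sum>y\<in>range (F n) - {0}. y * indicator (F n -` {y}) x)" by simp
      qed
      moreover have "step_approximable p (\<lambda>x. \<Sum>y\<in>range (F n) - {0}. y * indicator (F n -` {y}) x)"
      proof (rule step_approximable_sum)
        fix y assume y: "y \<in> range (F n) - {0}"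
        have m: "F n -` {y} \<in> sets borel"
          using measurable_sets[of "F n" borel borel "{y}"] by simp
        \<comment> \<open>Chebyshev's argument: on its level set \<open>F n\<close> equals y, so the
          left side is below \<bar>F n\<bar>; as y is nonzero, the level set has finite
          measure.\<close>
        have "integrable lborel (\<lambda>x. \<bar>y\<bar> * indicator (F n -` {y}) x)"
          by (rule Bochner_Integration.integrable_bound[OF int]) (use m in \<open>auto simp: indicator_def\<close>)
        then have "integrable lborel (indicator (F n -` {y}) :: real \<Rightarrow> real)"
          using y by simp
        then have "emeasure lborel (F n -` {y}) < \<infinity>"
          by (simp add: integrable_indicator_iff)
        then show "step_approximable p (indicator (F n -` {y}))"
          by (rule step_approximable_indicator[OF p m])
      qed (use p fin in auto)
      ultimately show ?thesis by simp
    qed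
  qed (use F(2) in auto)
qed

section \<open>Moments of stable variables\<close>

text \<open>Rescaling \<open>x\<close> by a power of 2 into \<open>{1..<2}\<close>, where \<open>1 - cos\<close> is at least \<open>1 - cos 1\<close>,
  bounds \<open>\<bar>x\<bar> powr p\<close> by a series whose expectation is read off the characteristic function.\<close>

lemma abs_powr_le_cos_series:
  fixes p x :: real
  assumes p: "0 \<le> p"
  shows "ennreal (\<bar>x\<bar> powr p) \<le> 1 + ennreal (2 powr p / (1 - cos 1))
    * (\<Sum>k. ennreal (2 powr (p * real k) * (1 - cos (x / 2 ^ k))))"
    (is "_ \<le> 1 + ennreal ?c * (\<Sum>k. ?T k)")
proof (cases "\<bar>x\<bar> < 1")
  case True
  then have "\<bar>x\<bar> powr p \<le> 1 powr p" using p by (intro powr_mono2) auto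
  then have "ennreal (\<bar>x\<bar> powr p) \<le> 1"
    using ennreal_leI by fastforce
  also have "\<dots> \<le> 1 + ennreal ?c * (\<Sum>k. ?T k)" by simp
  finally show ?thesis .
next
  case False
  have term_le: "T k \<le> (\<Sum>k. T k)" for T :: "nat \<Rightarrow> ennreal" and k
    using sum_le_suminf[OF summableI, of "{k}" T] by simp
  have cos1: "cos 1 < (1::real)"
    using cos_monotone_0_pi[of 0 1] pi_gt3 by simp
  \<comment> \<open>The dyadic scale of x: with n = k + 1, 2^k \<le> \<bar>x\<bar> < 2^(k+1). Only
    the k-th term of the series is used; the 1 in the bound serves \<bar>x\<bar> < 1.\<close>
  define n where "n = (LEAST n. \<bar>x\<bar> < 2 ^ n)"
  have "\<exists>n. \<bar>x\<bar> < 2 ^ n" by (rule real_arch_pow) simp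
  then have n: "\<bar>x\<bar> < 2 ^ n" unfolding n_def by (rule LeastI_ex)
  with False have "n \<noteq> 0" by (cases n) auto
  then obtain k where k: "n = Suc k" by (cases n) auto
  have "\<not> \<bar>x\<bar> < 2 ^ k" using not_less_Least[of k "\<lambda>n. \<bar>x\<bar> < 2 ^ n"] k by (simp add: n_def)
  then have y: "1 \<le> \<bar>x\<bar> / 2 ^ k" "\<bar>x\<bar> / 2 ^ k \<le> 2" using n k by (auto simp: field_simps)
  have "cos (\<bar>x\<bar> / 2 ^ k) \<le> cos 1"
    using y pi_gt3 by (intro cos_monotone_0_pi_le) auto
  moreover have "cos (x / 2 ^ k) = cos (\<bar>x\<bar> / 2 ^ k)"
    by (metis abs_divide abs_numeral cos_abs_real power_abs)
  ultimately have c: "1 \<le> (1 - cos (x / 2 ^ k)) / (1 - cos 1)"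
    using cos1 by simp
  \<comment> \<open>This explains the constant: \<open>2 powr p\<close> pays for rounding
    \<bar>x\<bar> up to 2^(k+1), and 1 / (1 - cos 1) for replacing 1 by the cosine term.\<close>
  have "\<bar>x\<bar> powr p \<le> (2 * 2 ^ k) powr p"
    using n k p by (intro powr_mono2) auto
  also have "\<dots> = 2 powr p * 2 powr (p * real k)"
    by (simp add: powr_mult powr_realpow[symmetric] powr_powr mult.commute)
  also have "\<dots> \<le> 2 powr p * 2 powr (p * real k) * ((1 - cos (x / 2 ^ k)) / (1 - cos 1))"
    using mult_left_mono[OF c, of "2 powr p * 2 powr (p * real k)"] by simp
  also have "\<dots> = ?c * (2 powr (p * real k) * (1 - cos (x / 2 ^ k)))" by simp
  finally have "ennreal (\<bar>x\<bar> powr p) \<le> ennreal ?c * ?T k"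
    using cos1 by (subst ennreal_mult[symmetric]) (auto intro!: ennreal_leI)
  also have "ennreal ?c * ?T k \<le> ennreal ?c * (\<Sum>k. ?T k)"
    by (rule mult_left_mono[OF term_le zero_le])
  also have "\<dots> \<le> 1 + ennreal ?c * (\<Sum>k. ?T k)"
    by (rule add_increasing[OF zero_le order_refl])
  finally show ?thesis .
qed

text \<open>The expectation of 1 - cos (\<theta> X) is at most \<bar>\<theta>\<bar>^\<alpha>. At
  \<theta> = 2^(-k) the k-th term of the series thus has expectation at most 2^((p - \<alpha>) k), a
  geometric series exactly because p < \<alpha>.\<close>

lemma (in prob_space) integrable_abs_powr_stable:
  fixes X :: "'a \<Rightarrow> real"
  assumes X[measurable]: "X \<in> borel_measurable M" and p: "0 < p" "p < \<alpha>"
    and char: "\<And>\<theta>. char (distr M borel X) \<theta> = of_real (exp (- (\<bar>\<theta>\<bar> powr \<alpha>)))"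
  shows "integrable M (\<lambda>\<omega>. \<bar>X \<omega>\<bar> powr p)"
proof -
  have icos: "integrable M (\<lambda>\<omega>. cos (\<theta> * X \<omega>))" for \<theta>
    by (rule integrable_const_bound[of _ 1]) auto
  have cos: "expectation (\<lambda>\<omega>. 1 - cos (\<theta> * X \<omega>)) \<le> \<bar>\<theta>\<bar> powr \<alpha>" for \<theta>
  proof -
    have "char (distr M borel X) \<theta> = (CLINT \<omega>|M. iexp (\<theta> * X \<omega>))"
      unfolding char_def by (subst integral_distr) auto
    also have "Re \<dots> = expectation (\<lambda>\<omega>. Re (iexp (\<theta> * X \<omega>)))"
      by (subst integral_Re) (auto intro!: integrable_const_bound[of _ 1])
    finally have "expectation (\<lambda>\<omega>. cos (\<theta> * X \<omega>)) = exp (- (\<bar>\<theta>\<bar> powr \<alpha>))"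
      by (simp add: char Re_exp)
    moreover have "expectation (\<lambda>\<omega>. 1 - cos (\<theta> * X \<omega>)) = 1 - expectation (\<lambda>\<omega>. cos (\<theta> * X \<omega>))"
      using icos by (simp add: prob_space)
    \<comment> \<open>The inequality 1 - exp (- u) \<le> u.\<close>
    ultimately show ?thesis
      using exp_ge_add_one_self[of "- (\<bar>\<theta>\<bar> powr \<alpha>)"] by simp
  qed
  let ?c = "2 powr p / (1 - cos 1) :: real"
  let ?T = "\<lambda>k \<omega>. 2 powr (p * real k) * (1 - cos (X \<omega> / 2 ^ k))"
  have T: "(\<integral>\<^sup>+\<omega>. ennreal (?T k \<omega>) \<partial>M) \<le> ennreal ((2 powr (p - \<alpha>)) ^ k)" for k
  proof -
    have ik: "integrable M (?T k)"
      using icos[of "1 / 2 ^ k"] by simp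
    have "(\<integral>\<^sup>+\<omega>. ennreal (?T k \<omega>) \<partial>M) = ennreal (expectation (?T k))"
      by (rule nn_integral_eq_integral[OF ik]) auto
    also have "expectation (?T k) = 2 powr (p * real k) * expectation (\<lambda>\<omega>. 1 - cos (1 / 2 ^ k * X \<omega>))"
      by simp
    also have "\<dots> \<le> 2 powr (p * real k) * \<bar>1 / 2 ^ k\<bar> powr \<alpha>"
      by (intro mult_left_mono cos) auto
    also have "\<dots> = (2 powr (p - \<alpha>)) ^ k"
      by (simp add: powr_divide powr_realpow[symmetric] powr_powr powr_diff[symmetric] algebra_simps)
    finally show ?thesis by (simp add: ennreal_leI)
  qed
  have "(\<integral>\<^sup>+\<omega>. ennreal (\<bar>X \<omega>\<bar> powr p) \<partial>M)
      \<le> (\<integral>\<^sup>+\<omega>. 1 + ennreal ?c * (\<Sum>k. ennreal (?T k \<omega>)) \<partial>M)"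
    using p by (intro nn_integral_mono abs_powr_le_cos_series) auto
  also have "\<dots> = 1 + ennreal ?c * (\<Sum>k. \<integral>\<^sup>+\<omega>. ennreal (?T k \<omega>) \<partial>M)"
    by (simp add: nn_integral_add nn_integral_cmult nn_integral_suminf emeasure_space_1)
  also have "\<dots> \<le> 1 + ennreal ?c * (\<Sum>k. ennreal ((2 powr (p - \<alpha>)) ^ k))"
    by (intro add_left_mono mult_left_mono suminf_le T) auto
  also have "(\<Sum>k. ennreal ((2 powr (p - \<alpha>)) ^ k)) \<noteq> \<infinity>"
  proof -
    have "2 powr (p - \<alpha>) < (1::real)" using p by (simp add: powr_less_one)
    then have "(\<Sum>k. ennreal ((2 powr (p - \<alpha>)) ^ k)) \<noteq> top"
      by (intro ennreal_suminf_neq_top summable_geometric) auto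
    then show ?thesis by simp
  qed
  then have "1 + ennreal ?c * (\<Sum>k. ennreal ((2 powr (p - \<alpha>)) ^ k)) < \<infinity>"
    by (simp add: ennreal_mult_less_top less_top)
  finally show ?thesis
    by (intro integrableI_nonneg) auto
qed

section \<open>The stable integral is a multiple of an isometry\<close>

lemma (in SaS_motion) char_L1: "char (distr M borel (L 1)) \<theta> = of_real (exp (- (\<bar>\<theta>\<bar> powr \<alpha>)))"
proof -
  have "distr M borel (L 1) = distr M borel (\<lambda>\<omega>. L 1 \<omega> - L 0 \<omega>)"
    using L_zero L_measurable by (intro distr_cong_AE) (auto elim: eventually_mono)
  then show ?thesis using L_char_increments[of 0 1 \<theta>] by simp
qed

context stable_integral
begin

lemma distr_J_eq_scaled:
  assumes \<alpha>: "0 < \<alpha>" and f: "f \<in> Lp_space lborel \<alpha>"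
  shows "distr M borel (J f) = distr M borel (\<lambda>\<omega>. Lp_norm lborel \<alpha> f * L 1 \<omega>)"
proof (rule Levy_uniqueness)
  note [measurable] = J_measurable[OF f] L_measurable
  show "real_distribution (distr M borel (J f))"
    "real_distribution (distr M borel (\<lambda>\<omega>. Lp_norm lborel \<alpha> f * L 1 \<omega>))"
    by (auto intro!: real_distribution_distr)
  let ?c = "Lp_norm lborel \<alpha> f"
  have c: "?c powr \<alpha> = (LINT x|lborel. \<bar>f x\<bar> powr \<alpha>)" "0 \<le> ?c"
    using \<alpha> by (simp_all add: Lp_norm_def powr_powr)
  show "char (distr M borel (J f)) = char (distr M borel (\<lambda>\<omega>. ?c * L 1 \<omega>))"
  proof
    fix \<theta>
    have "char (distr M borel (\<lambda>\<omega>. ?c * L 1 \<omega>)) \<theta> = char (distr M borel (L 1)) (\<theta> * ?c)"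
      unfolding char_def by (simp add: integral_distr mult.assoc)
    also have "\<dots> = of_real (exp (- (\<bar>\<theta> * ?c\<bar> powr \<alpha>)))" by (rule char_L1)
    also have "\<bar>\<theta> * ?c\<bar> powr \<alpha> = \<bar>\<theta>\<bar> powr \<alpha> * (LINT x|lborel. \<bar>f x\<bar> powr \<alpha>)"
      using c by (simp add: abs_mult powr_mult)
    finally show "char (distr M borel (J f)) \<theta> = char (distr M borel (\<lambda>\<omega>. ?c * L 1 \<omega>)) \<theta>"
      by (simp add: J_char[OF f])
  qed
qed

lemma
  assumes p: "0 < p" "p < \<alpha>" and f: "f \<in> Lp_space lborel \<alpha>"
  shows J_in_Lp: "J f \<in> Lp_space M p"
    and Lp_norm_J: "Lp_norm M p (J f) = Lp_norm M p (L 1) * Lp_norm lborel \<alpha> f"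
proof -
  note [measurable] = J_measurable[OF f] L_measurable
  have int: "integrable M (\<lambda>\<omega>. \<bar>L 1 \<omega>\<bar> powr p)"
    using integrable_abs_powr_stable[OF L_measurable p char_L1] .
  let ?c = "Lp_norm lborel \<alpha> f"
  have c: "0 \<le> ?c" by (simp add: Lp_norm_def)
  have eq: "distr M borel (J f) = distr M borel (\<lambda>\<omega>. ?c * L 1 \<omega>)"
    using p f by (intro distr_J_eq_scaled) auto
  have eqc: "(\<lambda>\<omega>. \<bar>?c * L 1 \<omega>\<bar> powr p) = (\<lambda>\<omega>. ?c powr p * \<bar>L 1 \<omega>\<bar> powr p)"
    using c by (simp add: abs_mult powr_mult)
  have "integrable (distr M borel (\<lambda>\<omega>. ?c * L 1 \<omega>)) (\<lambda>x. \<bar>x\<bar> powr p)"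
    by (subst integrable_distr_eq) (auto simp: eqc int)
  then have "integrable M (\<lambda>\<omega>. \<bar>J f \<omega>\<bar> powr p)"
    unfolding eq[symmetric] by (subst (asm) integrable_distr_eq) auto
  then show "J f \<in> Lp_space M p" by (simp add: Lp_space_iff)
  have "(LINT \<omega>|M. \<bar>J f \<omega>\<bar> powr p) = (LINT x|distr M borel (J f). \<bar>x\<bar> powr p)"
    by (subst integral_distr) auto
  also have "\<dots> = (LINT \<omega>|M. \<bar>?c * L 1 \<omega>\<bar> powr p)"
    unfolding eq by (subst integral_distr) auto
  also have "\<dots> = ?c powr p * (LINT \<omega>|M. \<bar>L 1 \<omega>\<bar> powr p)"
    by (simp add: eqc)
  finally have "(LINT \<omega>|M. \<bar>J f \<omega>\<bar> powr p) = ?c powr p * (LINT \<omega>|M. \<bar>L 1 \<omega>\<bar> powr p)" .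
  moreover have "(?c powr p * I) powr (1 / p) = I powr (1 / p) * ?c" for I
    using p c by (simp add: powr_mult powr_powr)
  ultimately show "Lp_norm M p (J f) = Lp_norm M p (L 1) * ?c"
    by (simp only: Lp_norm_def)
qed

text \<open>The difference has norm 0 in L^\<alpha>, so its stable integral has norm 0 by the moment
  identity; linearity then separates the two integrals.\<close>

lemma J_cong_AE:
  assumes \<alpha>: "0 < \<alpha>" and f: "f \<in> Lp_space lborel \<alpha>" and g: "g \<in> Lp_space lborel \<alpha>"
    and eq: "AE x in lborel. f x = g x"
  shows "AE \<omega> in M. J f \<omega> = J g \<omega>"
proof -
  let ?h = "\<lambda>x. 1 * f x + (- 1) * g x"
  have h: "?h \<in> Lp_space lborel \<alpha>"
    using f g \<alpha> by (intro Lp_space_lincomb) auto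
  \<comment> \<open>Any exponent strictly between 0 and \<alpha> would do; no p is fixed in this
    context.\<close>
  have p: "0 < \<alpha> / 2" "\<alpha> / 2 < \<alpha>" using \<alpha> by auto
  have "Lp_norm lborel \<alpha> ?h = Lp_norm lborel \<alpha> (\<lambda>x::real. 0)"
    using f g eq by (intro Lp_norm_cong_AE) (auto simp: Lp_space_iff elim: eventually_mono)
  then have "Lp_norm M (\<alpha> / 2) (J ?h) = 0"
    using Lp_norm_J[OF p h] by (simp add: Lp_norm_def)
  then have "AE \<omega> in M. J ?h \<omega> = 0"
    by (rule AE_eq_0_if_Lp_norm_eq_0[OF J_in_Lp[OF p h]])
  with J_linear[OF f g, of 1 "- 1"] show ?thesis
    by eventually_elim simp
qed

lemma J_sum:
  assumes \<alpha>: "0 \<le> \<alpha>" and "finite A" "\<And>i. i \<in> A \<Longrightarrow> f i \<in> Lp_space lborel \<alpha>"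
  shows "AE \<omega> in M. J (\<lambda>x. \<Sum>i\<in>A. c i * f i x) \<omega> = (\<Sum>i\<in>A. c i * J (f i) \<omega>)"
  using assms(2,3)
proof (induction A)
  case empty
  \<comment> \<open>Linearity with both coefficients 0 gives \<open>J\<close> of the zero function,
    almost surely 0.\<close>
  have "(\<lambda>x. 0) \<in> Lp_space lborel \<alpha>" by (simp add: Lp_space_iff)
  from J_linear[OF this this, of 0 0] show ?case by simp
next
  case (insert i A)
  have "AE \<omega> in M. J (\<lambda>x. c i * f i x + 1 * (\<Sum>i\<in>A. c i * f i x)) \<omega>
      = c i * J (f i) \<omega> + 1 * J (\<lambda>x. \<Sum>i\<in>A. c i * f i x) \<omega>"
    using insert.prems insert.hyps \<alpha> by (intro J_linear Lp_space_sum) auto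
  moreover have "AE \<omega> in M. J (\<lambda>x. \<Sum>i\<in>A. c i * f i x) \<omega> = (\<Sum>i\<in>A. c i * J (f i) \<omega>)"
    using insert by simp
  ultimately show ?case
    by eventually_elim (use insert.hyps in simp)
qed

end

section \<open>The integral with respect to linear fractional stable motion\<close>

locale fractional_stable_integral = stable_integral +
  fixes d p :: real
  assumes \<alpha>: "1 < \<alpha>" and d: "0 < d" "d < 1 - 1 / \<alpha>" and p: "1 < p" "p < \<alpha>"
begin

definition LFSM_integral :: "(real \<Rightarrow> real) \<Rightarrow> 'a \<Rightarrow> real" where
  "LFSM_integral g = J (RL_integral d g)"

abbreviation L1\<alpha> :: "(real \<Rightarrow> real) set" where
  "L1\<alpha> \<equiv> Lp_space lborel 1 \<inter> Lp_space lborel \<alpha>"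

lemma L1\<alpha>_diff: "f \<in> L1\<alpha> \<Longrightarrow> g \<in> L1\<alpha> \<Longrightarrow> (\<lambda>x. f x - g x) \<in> L1\<alpha>"
  using \<alpha> by (intro L1p_diff) auto

lemma step_function_L1\<alpha>: "step_function \<phi> \<Longrightarrow> \<phi> \<in> L1\<alpha>"
  using \<alpha> by (intro step_in_L1p) auto

lemma RL_in_L\<alpha>: "g \<in> L1\<alpha> \<Longrightarrow> RL_integral d g \<in> Lp_space lborel \<alpha>"
  by (rule RL_integral_in_Lp[OF \<alpha> d])

lemma LFSM_integral_in_Lp: "g \<in> L1\<alpha> \<Longrightarrow> LFSM_integral g \<in> Lp_space M p"
  unfolding LFSM_integral_def using p by (intro J_in_Lp RL_in_L\<alpha>) auto

lemma Lp_norm_LFSM_integral: "g \<in> L1\<alpha> \<Longrightarrow> Lp_norm M p (LFSM_integral g) = B_norm M L \<alpha> d p g"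
  unfolding LFSM_integral_def B_norm_def using p by (intro Lp_norm_J RL_in_L\<alpha>) auto

lemma LFSM_integral_diff:
  assumes f: "f \<in> L1\<alpha>" and g: "g \<in> L1\<alpha>"
  shows "AE \<omega> in M. LFSM_integral (\<lambda>x. f x - g x) \<omega> = LFSM_integral f \<omega> - LFSM_integral g \<omega>"
proof -
  let ?h = "\<lambda>x. 1 * RL_integral d f x + (- 1) * RL_integral d g x"
  have "?h \<in> Lp_space lborel \<alpha>"
    using \<alpha> f g by (intro Lp_space_lincomb RL_in_L\<alpha>) auto
  moreover have "AE x in lborel. RL_integral d (\<lambda>x. f x - g x) x = ?h x"
    using RL_integral_lincomb_AE[OF \<alpha> d f g, of 1 "- 1"] by simp
  ultimately have "AE \<omega> in M. J (RL_integral d (\<lambda>x. f x - g x)) \<omega> = J ?h \<omega>"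
    using \<alpha> by (intro J_cong_AE RL_in_L\<alpha> L1\<alpha>_diff f g) auto
  moreover have "AE \<omega> in M. J ?h \<omega> = 1 * J (RL_integral d f) \<omega> + (- 1) * J (RL_integral d g) \<omega>"
    by (intro J_linear RL_in_L\<alpha> f g)
  ultimately show ?thesis
    unfolding LFSM_integral_def by eventually_elim simp
qed

lemma Gamma_pos: "0 < Gamma (d + 1)"
  using d by (intro Gamma_real_pos) simp

lemma Ioc_L1\<alpha>: "s \<le> t \<Longrightarrow> indicator {s<..t} \<in> L1\<alpha>"
  by (intro step_function_L1\<alpha> step_function_indicator)

text \<open>Integrability of the kernel is read off from boundedness of the fractional integral on
  an indicator, in place of an estimate as x tends to -\<infinity>. For t < 0 the interval is
  reversed and the sign changes. Membership is what lets the axioms for \<open>J\<close> apply to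
  the motion.\<close>

lemma LFSM_kernel_in_L\<alpha>:
  "(\<lambda>x. max (t - x) 0 powr d - max (- x) 0 powr d) \<in> Lp_space lborel \<alpha>" (is "?k \<in> _")
proof (cases "0 \<le> t")
  case True
  have "?k = (\<lambda>x. Gamma (d + 1) * RL_integral d (indicator {0<..t}) x)"
    using RL_integral_indicator[OF d(1) True] Gamma_pos by simp
  also have "\<dots> \<in> Lp_space lborel \<alpha>"
    using \<alpha> True by (intro Lp_space_cmult RL_in_L\<alpha> Ioc_L1\<alpha>) auto
  finally show ?thesis .
next
  case False
  have "?k = (\<lambda>x. - Gamma (d + 1) * RL_integral d (indicator {t<..0}) x)"
    using RL_integral_indicator[OF d(1), of t 0] False Gamma_pos by simp
  also have "\<dots> \<in> Lp_space lborel \<alpha>"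
    using \<alpha> False by (intro Lp_space_cmult RL_in_L\<alpha> Ioc_L1\<alpha>) auto
  finally show ?thesis .
qed

lemma LFSM_measurable [measurable]: "LFSM J d t \<in> borel_measurable M"
  unfolding LFSM_def[abs_def] using J_measurable[OF LFSM_kernel_in_L\<alpha>[of t]] by simp

text \<open>The reference terms (-x)_+^d cancel in the difference, leaving the fractional integral
  of the indicator.\<close>

lemma LFSM_increment:
  assumes "s \<le> t"
  shows "AE \<omega> in M. LFSM J d t \<omega> - LFSM J d s \<omega> = LFSM_integral (indicator {s<..t}) \<omega>"
proof -
  let ?k = "\<lambda>t x. max (t - x) 0 powr d - max (- x) 0 powr d"
  let ?G = "1 / Gamma (d + 1)"
  have "RL_integral d (indicator {s<..t}) = (\<lambda>x. ?G * ?k t x + (- ?G) * ?k s x)"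
    using RL_integral_indicator[OF d(1) assms] by (auto simp: fun_eq_iff diff_divide_distrib)
  then show ?thesis
    using J_linear[OF LFSM_kernel_in_L\<alpha>[of t] LFSM_kernel_in_L\<alpha>[of s], of ?G "- ?G"]
    unfolding LFSM_integral_def by (auto simp: LFSM_def)
qed

lemma step_integral_measurable:
  assumes "step_function \<phi>"
  shows "step_integral (LFSM J d) \<phi> \<in> borel_measurable M"
proof -
  obtain n a t where r: "step_repr \<phi> n a t"
    using assms by (auto simp: step_function_def)
  show ?thesis unfolding step_integral_eq[OF r, abs_def] by measurable
qed

lemma step_integral_eq_LFSM_integral:
  assumes "step_function \<phi>"
  shows "AE \<omega> in M. step_integral (LFSM J d) \<phi> \<omega> = LFSM_integral \<phi> \<omega>"
proof -
  obtain n a t where r: "step_repr \<phi> n a t"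
    using assms by (auto simp: step_function_def)
  let ?f = "\<lambda>i. indicator {t i<..t (Suc i)} :: real \<Rightarrow> real"
  have L: "?f i \<in> L1\<alpha>" if "i \<in> {1..<n}" for i
    using step_reprD(2)[OF r that] by (rule Ioc_L1\<alpha>)
  \<comment> \<open>Each increment has its own exceptional null set; there are finitely
    many.\<close>
  have "AE \<omega> in M. \<forall>i\<in>{1..<n}. LFSM J d (t (Suc i)) \<omega> - LFSM J d (t i) \<omega> = LFSM_integral (?f i) \<omega>"
    using step_reprD(2)[OF r] by (intro AE_finite_allI LFSM_increment) auto
  moreover have "AE \<omega> in M. J (\<lambda>x. \<Sum>i\<in>{1..<n}. a i * RL_integral d (?f i) x) \<omega>
      = (\<Sum>i\<in>{1..<n}. a i * LFSM_integral (?f i) \<omega>)"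
    unfolding LFSM_integral_def using \<alpha> by (intro J_sum RL_in_L\<alpha> L) auto
  \<comment> \<open>The two integrands agree only almost everywhere, so \<open>J_cong_AE\<close> has
    to mediate.\<close>
  moreover have "AE \<omega> in M. LFSM_integral \<phi> \<omega> = J (\<lambda>x. \<Sum>i\<in>{1..<n}. a i * RL_integral d (?f i) x) \<omega>"
    unfolding LFSM_integral_def
  proof (intro J_cong_AE RL_in_L\<alpha> Lp_space_sum L step_function_L1\<alpha> assms)
    show "AE x in lborel. RL_integral d \<phi> x = (\<Sum>i\<in>{1..<n}. a i * RL_integral d (?f i) x)"
      using RL_integral_sum_AE[OF \<alpha> d, of "{1..<n}" ?f a] L step_reprD(1)[OF r] by simp
  qed (use \<alpha> in auto)
  ultimately show ?thesis
    by eventually_elim (simp add: step_integral_eq[OF r])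
qed

text \<open>The norm of the difference equals the \<open>B_norm\<close> of \<phi> n - g for each n.
  The limit I need only agree almost surely with the integral of g, so that one I can serve a whole
  equivalence class.\<close>

lemma step_integral_converges:
  assumes \<phi>: "\<And>n. step_function (\<phi> n)" and g: "g \<in> L1\<alpha>" and I: "I \<in> Lp_space M p"
    and eq: "AE \<omega> in M. LFSM_integral g \<omega> = I \<omega>"
    and lim: "(\<lambda>n. B_norm M L \<alpha> d p (\<lambda>x. \<phi> n x - g x)) \<longlonglongrightarrow> 0"
  shows "Lp_converges M p (\<lambda>n. step_integral (LFSM J d) (\<phi> n)) I"
proof -
  note \<phi>L = step_function_L1\<alpha>[OF \<phi>]
  have [measurable]: "LFSM_integral h \<in> borel_measurable M" if "h \<in> L1\<alpha>" for h
    using LFSM_integral_in_Lp[OF that] by (simp add: Lp_space_iff)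
  have Im[measurable]: "I \<in> borel_measurable M" using I by (simp add: Lp_space_iff)
  note [measurable] = step_integral_measurable[OF \<phi>]
  have X: "step_integral (LFSM J d) (\<phi> n) \<in> Lp_space M p" for n
  proof -
    have "integrable M (\<lambda>\<omega>. \<bar>LFSM_integral (\<phi> n) \<omega>\<bar> powr p)"
      using LFSM_integral_in_Lp[OF \<phi>L] by (simp add: Lp_space_iff)
    then have "integrable M (\<lambda>\<omega>. \<bar>step_integral (LFSM J d) (\<phi> n) \<omega>\<bar> powr p)"
    proof (rule integrable_cong_AE_imp)
      show "AE \<omega> in M. \<bar>LFSM_integral (\<phi> n) \<omega>\<bar> powr p = \<bar>step_integral (LFSM J d) (\<phi> n) \<omega>\<bar> powr p"
        using step_integral_eq_LFSM_integral[OF \<phi>[of n]] by eventually_elim simp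
    qed measurable
    then show ?thesis by (simp add: Lp_space_iff)
  qed
  have "Lp_norm M p (\<lambda>\<omega>. step_integral (LFSM J d) (\<phi> n) \<omega> - I \<omega>) = B_norm M L \<alpha> d p (\<lambda>x. \<phi> n x - g x)" for n
  proof -
    have D: "(\<lambda>x. \<phi> n x - g x) \<in> L1\<alpha>" by (rule L1\<alpha>_diff[OF \<phi>L g])
    have "Lp_norm M p (\<lambda>\<omega>. step_integral (LFSM J d) (\<phi> n) \<omega> - I \<omega>)
        = Lp_norm M p (LFSM_integral (\<lambda>x. \<phi> n x - g x))"
    proof (rule Lp_norm_cong_AE)
      show "AE \<omega> in M. step_integral (LFSM J d) (\<phi> n) \<omega> - I \<omega> = LFSM_integral (\<lambda>x. \<phi> n x - g x) \<omega>"
        using LFSM_integral_diff[OF \<phi>L[of n] g] step_integral_eq_LFSM_integral[OF \<phi>[of n]] eq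
        by eventually_elim simp
    qed (use D in measurable)
    then show ?thesis using Lp_norm_LFSM_integral[OF D] by simp
  qed
  then show ?thesis
    using X I lim by (simp add: Lp_converges_def)
qed

lemma step_functions_dense:
  assumes g: "g \<in> L1\<alpha>"
  shows "\<exists>\<phi>. (\<forall>n::nat. step_function (\<phi> n)) \<and> (\<lambda>n. B_norm M L \<alpha> d p (\<lambda>x. \<phi> n x - g x)) \<longlonglongrightarrow> 0"
proof -
  obtain \<phi> where \<phi>: "\<And>n::nat. step_function (\<phi> n)"
      and lim: "(\<lambda>n. L1p_modulus \<alpha> (\<lambda>x. \<phi> n x - g x)) \<longlonglongrightarrow> 0"
    using step_approximable_L1p[OF _ g] \<alpha> by (auto simp: step_approximable_def)
  obtain C where C: "0 \<le> C" "\<And>h. h \<in> L1\<alpha> \<Longrightarrow> (LINT x|lborel. \<bar>RL_integral d h x\<bar> powr \<alpha>)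
      \<le> C * ((LINT x|lborel. \<bar>h x\<bar> powr \<alpha>) + (LINT x|lborel. \<bar>h x\<bar>) powr \<alpha>)"
    using RL_integral_bound[OF \<alpha> d] by blast
  let ?m = "\<lambda>n. L1p_modulus \<alpha> (\<lambda>x. \<phi> n x - g x)"
  let ?R = "\<lambda>n. LINT x|lborel. \<bar>RL_integral d (\<lambda>x. \<phi> n x - g x) x\<bar> powr \<alpha>"
  have "?R \<longlonglongrightarrow> 0"
  proof (rule tendsto_sandwich[OF _ _ tendsto_const])
    have "(\<lambda>n. ?m n powr \<alpha>) \<longlonglongrightarrow> 0"
      using lim \<alpha> by (intro tendsto_zero_powrI[OF _ tendsto_const]) (auto simp: L1p_modulus_nonneg)
    then show "(\<lambda>n. C * (?m n + ?m n powr \<alpha>)) \<longlonglongrightarrow> 0"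
      using tendsto_mult[OF tendsto_const[of C] tendsto_add[OF lim]] by fastforce
    \<comment> \<open>Both integrals in the bound are summands of the modulus m: one enters as it
      stands, the L^1 part through its power \<alpha>.\<close>
    have "?R n \<le> C * (?m n + ?m n powr \<alpha>)" for n
    proof -
      let ?h = "\<lambda>x. \<phi> n x - g x"
      have "?R n \<le> C * ((LINT x|lborel. \<bar>?h x\<bar> powr \<alpha>) + (LINT x|lborel. \<bar>?h x\<bar>) powr \<alpha>)"
        by (rule C(2)[OF L1\<alpha>_diff[OF step_function_L1\<alpha>[OF \<phi>] g]])
      also have "\<dots> \<le> C * (?m n + ?m n powr \<alpha>)"
        using \<alpha> unfolding L1p_modulus_def
        by (intro mult_left_mono[OF _ C(1)] add_mono powr_mono2) auto
      finally show ?thesis .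
    qed
    then show "\<forall>\<^sub>F n in sequentially. ?R n \<le> C * (?m n + ?m n powr \<alpha>)" by simp
  qed simp
  then have "(\<lambda>n. ?R n powr (1 / \<alpha>)) \<longlonglongrightarrow> 0"
    using \<alpha> by (intro tendsto_zero_powrI[OF _ tendsto_const]) auto
  then have "(\<lambda>n. Lp_norm M p (L 1) * ?R n powr (1 / \<alpha>)) \<longlonglongrightarrow> 0"
    by (rule tendsto_mult_right_zero)
  then have "(\<lambda>n. B_norm M L \<alpha> d p (\<lambda>x. \<phi> n x - g x)) \<longlonglongrightarrow> 0"
    by (simp add: B_norm_def Lp_norm_def[of lborel])
  with \<phi> show ?thesis by blast
qed

end

theorem theorem3p1:
  fixes M :: "'a measure"
    and L :: "real \<Rightarrow> 'a \<Rightarrow> real"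
    and J :: "(real \<Rightarrow> real) \<Rightarrow> 'a \<Rightarrow> real"
    and \<alpha> d p :: real
    and G :: "(real \<Rightarrow> real) set"
  assumes "1 < \<alpha>" and "\<alpha> < 2"
    and "0 < d" and "d < 1 - 1 / \<alpha>"
    and "1 < p" and "p < \<alpha>"
    and "stable_integral M \<alpha> L J"
    and "G \<in> B_space M L \<alpha> d p"
  shows "\<exists>I \<in> Lp_space M p. \<forall>g \<in> G.
    (\<exists>\<phi> :: nat \<Rightarrow> real \<Rightarrow> real. (\<forall>n. step_function (\<phi> n)) \<and>
       (\<lambda>n. B_norm M L \<alpha> d p (\<lambda>x. \<phi> n x - g x)) \<longlonglongrightarrow> 0 \<and>
       Lp_converges M p (\<lambda>n. step_integral (LFSM J d) (\<phi> n)) I) \<and>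
    (\<forall>\<phi> :: nat \<Rightarrow> real \<Rightarrow> real. (\<forall>n. step_function (\<phi> n)) \<longrightarrow>
       (\<lambda>n. B_norm M L \<alpha> d p (\<lambda>x. \<phi> n x - g x)) \<longlonglongrightarrow> 0 \<longrightarrow>
       Lp_converges M p (\<lambda>n. step_integral (LFSM J d) (\<phi> n)) I) \<and>
    Lp_norm M p I = B_norm M L \<alpha> d p g"
proof -
  interpret stable_integral M \<alpha> L J by fact
  interpret fractional_stable_integral M \<alpha> L J d p
    by unfold_locales (use assms in auto)
  obtain g0 where g0: "g0 \<in> L1\<alpha>" and G: "G = B_rel M L \<alpha> d p `` {g0}"
    using assms(8) unfolding B_space_def by (auto elim!: quotientE)
  \<comment> \<open>The random variable has to be fixed before g ranges over G, so it is built from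
    one representative.\<close>
  define I where "I = LFSM_integral g0"
  have I: "I \<in> Lp_space M p"
    unfolding I_def by (rule LFSM_integral_in_Lp[OF g0])
  show ?thesis
  proof (intro bexI[OF _ I] ballI)
    fix g assume "g \<in> G"
    then have g: "g \<in> L1\<alpha>" and eq0: "B_norm M L \<alpha> d p (\<lambda>x. g0 x - g x) = 0"
      by (auto simp: G B_rel_def)
    note D = L1\<alpha>_diff[OF g0 g]
    \<comment> \<open>The isometry turns \<open>B_norm\<close> 0 of the difference of two
      representatives into almost sure equality of their integrals.\<close>
    have "AE \<omega> in M. LFSM_integral (\<lambda>x. g0 x - g x) \<omega> = 0"
      using AE_eq_0_if_Lp_norm_eq_0[OF LFSM_integral_in_Lp[OF D]] Lp_norm_LFSM_integral[OF D] eq0 by simp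
    then have eq: "AE \<omega> in M. LFSM_integral g \<omega> = I \<omega>"
      using LFSM_integral_diff[OF g0 g] unfolding I_def by eventually_elim simp
    \<comment> \<open>Here \<phi> is arbitrary, which is the independence of the approximating
      sequence; existence follows by feeding in a sequence from density.\<close>
    have conv: "Lp_converges M p (\<lambda>n. step_integral (LFSM J d) (\<phi> n)) I"
      if "\<And>n. step_function (\<phi> n)" "(\<lambda>n. B_norm M L \<alpha> d p (\<lambda>x. \<phi> n x - g x)) \<longlonglongrightarrow> 0" for \<phi>
      by (rule step_integral_converges[OF that(1) g I eq that(2)])
    have "Lp_norm M p I = Lp_norm M p (LFSM_integral g)"
      using I LFSM_integral_in_Lp[OF g] eq
      by (intro Lp_norm_cong_AE) (auto simp: Lp_space_iff elim: eventually_mono)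
    then have "Lp_norm M p I = B_norm M L \<alpha> d p g"
      using Lp_norm_LFSM_integral[OF g] by simp
    moreover obtain \<phi> where "\<And>n::nat. step_function (\<phi> n)"
        "(\<lambda>n. B_norm M L \<alpha> d p (\<lambda>x. \<phi> n x - g x)) \<longlonglongrightarrow> 0"
      using step_functions_dense[OF g] by blast
    ultimately show "(\<exists>\<phi> :: nat \<Rightarrow> real \<Rightarrow> real. (\<forall>n. step_function (\<phi> n)) \<and>
         (\<lambda>n. B_norm M L \<alpha> d p (\<lambda>x. \<phi> n x - g x)) \<longlonglongrightarrow> 0 \<and>
         Lp_converges M p (\<lambda>n. step_integral (LFSM J d) (\<phi> n)) I) \<and>
      (\<forall>\<phi> :: nat \<Rightarrow> real \<Rightarrow> real. (\<forall>n. step_function (\<phi> n)) \<longrightarrow>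
         (\<lambda>n. B_norm M L \<alpha> d p (\<lambda>x. \<phi> n x - g x)) \<longlonglongrightarrow> 0 \<longrightarrow>
         Lp_converges M p (\<lambda>n. step_integral (LFSM J d) (\<phi> n)) I) \<and>
      Lp_norm M p I = B_norm M L \<alpha> d p g"
      using conv by blast
  qed
qed

end
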